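(* There exists $E\in\mathcal{I}$ (a compact isodiametric set in $\mathbb{H}^n$) such that $p\cdot E\notin\mathcal{R}$ for all $p\in\mathbb{H}^n$, i.e. no left translate of $E$ is rotationally invariant.
   Context: Let $n\ge 1$. The Heisenberg group is $\mathbb{H}^n=\mathbb{C}^n\times\mathbb{R}\approx\mathbb{R}^{2n+1}$ with points $[z,t]$, $z=(z_1,\dots,z_n)$, $z_j=x_j+iy_j$, and group law $[z,t]\cdot[z',t']=[z+z',\,t+t'+2\operatorname{Im} z\overline{z}']$, where $\operatorname{Im} z\overline z'=\sum_j\operatorname{Im} z_j\overline{z}'_j$. Put $X_j=\partial_{x_j}+2y_j\partial_t$, $Y_j=\partial_{y_j}-2x_j\partial_t$. A curve is horizontal if it is absolutely continuous and its tangent vector lies a.e. in $\operatorname{span}\{X_j,Y_j\}_{j}$. Fix the left-invariant Riemannian metric making $(X_1,\dots,X_n,Y_1,\dots,Y_n,\partial_t)$ orthonormal; the Carnot-Carathéodory distance $d(p,q)$ is the infimum of the Riemannian lengths of horizontal curves joining $p$ to $q$. Diameters are with respect to $d$; $\mathcal{L}^{2n+1}$ is Lebesgue (outer) measure on $\mathbb{R}^{2n+1}$; $p\cdot E=\{p\cdot q : q\in E\}$. $C_I=\sup\{\mathcal{L}^{2n+1}(F)/(\operatorname{diam}F)^{2n+2} : F\subset\mathbb{H}^n,\ 0<\operatorname{diam}F<+\infty\}$ and $\mathcal{I}=\{E\subset\mathbb{H}^n : E \text{ compact},\ \operatorname{diam}E>0,\ \mathcal{L}^{2n+1}(E)=C_I(\operatorname{diam}E)^{2n+2}\}$.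 For $\theta\in\mathbb{R}^n$ let $r_\theta([z,t])=[(e^{i\theta_1}z_1,\dots,e^{i\theta_n}z_n),t]$, and let $\mathcal{R}=\{F\subset\mathbb{H}^n : r_\theta(F)\subset F\text{ for all }\theta\in\mathbb{R}^n\}$ (rotationally invariant sets). *)

theory Defs
  imports "HOL-Analysis.Analysis"
begin

text \<open>
  The Heisenberg group of dimension \<open>2n+1\<close> is the Euclidean space
  \<open>complex ^ 'n \<times> real\<close> with \<open>n = CARD('n)\<close>. Its topology, \<open>compact\<close>, \<open>lebesgue\<close> and
  differentiation of curves are those of this Euclidean space.
\<close>

type_synonym 'n heis = "(complex ^ 'n) \<times> real"

definition heis_mult :: "('n::finite) heis \<Rightarrow> 'n heis \<Rightarrow> 'n heis" where
  "heis_mult p q =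
     (fst p + fst q, snd p + snd q + 2 * (\<Sum>j\<in>UNIV. Im (fst p $ j * cnj (fst q $ j))))"

definition heis_X :: "'n \<Rightarrow> ('n::finite) heis \<Rightarrow> 'n heis" where
  "heis_X j p = (axis j 1, 2 * Im (fst p $ j))"

definition heis_Y :: "'n \<Rightarrow> ('n::finite) heis \<Rightarrow> 'n heis" where
  "heis_Y j p = (axis j \<i>, - 2 * Re (fst p $ j))"

definition heis_T :: "('n::finite) heis" where
  "heis_T = (0, 1)"

text \<open>
  The coefficients of a tangent vector \<open>v\<close> at \<open>p\<close> in the frame \<open>X\<^sub>j, Y\<^sub>j, \<partial>\<^sub>t\<close> are
  \<open>Re (fst v $ j)\<close>, \<open>Im (fst v $ j)\<close> and \<open>heis_vert p v\<close>; see \<open>heis_frame_expansion\<close>.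
\<close>

definition heis_vert :: "('n::finite) heis \<Rightarrow> 'n heis \<Rightarrow> real" where
  "heis_vert p v =
     snd v - (\<Sum>j\<in>UNIV. 2 * Im (fst p $ j) * Re (fst v $ j) - 2 * Re (fst p $ j) * Im (fst v $ j))"

definition heis_metric :: "('n::finite) heis \<Rightarrow> 'n heis \<Rightarrow> 'n heis \<Rightarrow> real" where
  "heis_metric p v w =
     (\<Sum>j\<in>UNIV. Re (fst v $ j) * Re (fst w $ j) + Im (fst v $ j) * Im (fst w $ j))
     + heis_vert p v * heis_vert p w"

lemma heis_frame_expansion:
  "v = (\<Sum>j\<in>UNIV. Re (fst v $ j) *\<^sub>R heis_X j p + Im (fst v $ j) *\<^sub>R heis_Y j p)
       + heis_vert p v *\<^sub>R heis_T"
proof (rule prod_eqI)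
  show "fst v = fst ((\<Sum>j\<in>UNIV. Re (fst v $ j) *\<^sub>R heis_X j p + Im (fst v $ j) *\<^sub>R heis_Y j p)
       + heis_vert p v *\<^sub>R heis_T)"
    by (simp add: fst_sum heis_X_def heis_Y_def heis_T_def vec_eq_iff axis_def
          complex_eq_iff if_distrib[where f = Re] if_distrib[where f = Im]
          if_distrib[where f = "\<lambda>x. _ * x"] sum.distrib cong: if_cong)
  show "snd v = snd ((\<Sum>j\<in>UNIV. Re (fst v $ j) *\<^sub>R heis_X j p + Im (fst v $ j) *\<^sub>R heis_Y j p)
       + heis_vert p v *\<^sub>R heis_T)"
    by (simp add: snd_sum heis_X_def heis_Y_def heis_T_def heis_vert_def algebra_simps)
qed

lemma heis_vert_frame:
  "heis_vert p (heis_X j p) = 0" "heis_vert p (heis_Y j p) = 0" "heis_vert p heis_T = 1"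
  by (simp_all add: heis_vert_def heis_X_def heis_Y_def heis_T_def axis_def
        if_distrib[where f = Re] if_distrib[where f = Im]
        if_distrib[where f = "\<lambda>x. _ * x"] sum_subtractf sum_negf cong: if_cong)

lemma heis_metric_frame:
  "heis_metric p (heis_X i p) (heis_X j p) = (if i = j then 1 else 0)"
  "heis_metric p (heis_Y i p) (heis_Y j p) = (if i = j then 1 else 0)"
  "heis_metric p (heis_X i p) (heis_Y j p) = 0"
  "heis_metric p (heis_X i p) heis_T = 0"
  "heis_metric p (heis_Y i p) heis_T = 0"
  "heis_metric p heis_T heis_T = 1"
  by (simp_all add: heis_metric_def heis_vert_frame)
     (auto simp: heis_X_def heis_Y_def heis_T_def axis_def
        if_distrib[where f = Re] if_distrib[where f = Im]
        if_distrib[where f = "\<lambda>x. _ * x"] if_distrib[where f = "\<lambda>x. x * _"] cong: if_cong)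

definition abs_continuous_on :: "real \<Rightarrow> real \<Rightarrow> (real \<Rightarrow> 'a::metric_space) \<Rightarrow> bool" where
  "abs_continuous_on a b g \<longleftrightarrow>
     (\<forall>\<epsilon>>0. \<exists>\<delta>>0. \<forall>(m::nat) (u::nat \<Rightarrow> real) (v::nat \<Rightarrow> real).
        (\<forall>i<m. a \<le> u i \<and> u i \<le> v i \<and> v i \<le> b) \<and>
        disjoint_family_on (\<lambda>i. {u i<..<v i}) {..<m} \<and>
        (\<Sum>i<m. v i - u i) < \<delta>
        \<longrightarrow> (\<Sum>i<m. dist (g (u i)) (g (v i))) < \<epsilon>)"

definition horizontal_curve :: "real \<Rightarrow> real \<Rightarrow> (real \<Rightarrow> ('n::finite) heis) \<Rightarrow> bool" where
  "horizontal_curve a b g \<longleftrightarrow>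
     abs_continuous_on a b g \<and>
     (AE s in lebesgue. s \<in> {a..b} \<longrightarrow>
        g differentiable (at s) \<and>
        vector_derivative g (at s)
          \<in> span (range (\<lambda>j. heis_X j (g s)) \<union> range (\<lambda>j. heis_Y j (g s))))"

definition riem_length :: "real \<Rightarrow> real \<Rightarrow> (real \<Rightarrow> ('n::finite) heis) \<Rightarrow> ennreal" where
  "riem_length a b g =
     (\<integral>\<^sup>+s\<in>{a..b}. ennreal (sqrt (heis_metric (g s) (vector_derivative g (at s))
                                              (vector_derivative g (at s)))) \<partial>lebesgue)"

definition cc_dist :: "('n::finite) heis \<Rightarrow> 'n heis \<Rightarrow> ennreal" where
  "cc_dist p q =
     Inf {riem_length a b g | a b g. a \<le> b \<and> horizontal_curve a b g \<and> g a = p \<and> g b = q}"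

definition cc_diam :: "('n::finite) heis set \<Rightarrow> ennreal" where
  "cc_diam F = (SUP p\<in>F. SUP q\<in>F. cc_dist p q)"

definition isodiam_const :: "'n::finite itself \<Rightarrow> ennreal" where
  "isodiam_const _ =
     Sup {outer_measure_of lebesgue F / cc_diam F ^ (2 * CARD('n) + 2)
          | F :: 'n heis set. 0 < cc_diam F \<and> cc_diam F < top}"

definition isodiametric_sets :: "('n::finite) heis set set" where
  "isodiametric_sets =
     {E. compact E \<and> 0 < cc_diam E \<and>
         outer_measure_of lebesgue E = isodiam_const TYPE('n) * cc_diam E ^ (2 * CARD('n) + 2)}"

definition heis_rot :: "real ^ 'n \<Rightarrow> ('n::finite) heis \<Rightarrow> 'n heis" where
  "heis_rot \<theta> p = ((\<chi> j. exp (\<i> * complex_of_real (\<theta> $ j)) * fst p $ j), snd p)"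

definition rot_invariant_sets :: "('n::finite) heis set set" where
  "rot_invariant_sets = {F. \<forall>\<theta>. heis_rot \<theta> ` F \<subseteq> F}"

end

theory Submission
  imports Defs "HOL-Complex_Analysis.Great_Picard"
begin

text \<open>
  By a calibration, \<open>d(p, q) \<le> D\<close> holds iff \<open>\<phi> cot \<phi> |w|\<^sup>2 + \<phi> |\<tau>| \<le> D\<^sup>2\<close> for all
  \<open>0 < \<phi> < pi\<close>, where \<open>p\<^sup>-\<^sup>1 q = [w, \<tau>]\<close>. This condition is closed, so Blaschke selection yields a
  compact isodiametric set. If one of its translates \<open>E\<close> is rotationally invariant, comparing \<open>[z, t]\<close> with
  \<open>[- e\<^sup>2\<^sup>i\<^sup>\<phi> z, t']\<close> in \<open>E\<close> shows that the vertical sections of \<open>E\<close> are no longer than those of the convex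
  hull of the ball whose diameter is that of \<open>E\<close>. Over a neighbourhood of the axis this hull is flat, and there
  only pairs of points on a common vertical line realise its diameter. Moving the hull vertically by a
  small Lipschitz bump supported near the axis therefore increases neither the diameter nor the
  volume. The result is again isodiametric, and no translate of it is rotationally invariant if the bump is
  not centred on the axis.
\<close>

text \<open>No volume of a particular set is computed: either no translate of the set found by
  compactness is invariant, and that set is the answer, or the hull matches it in volume and
  diameter. The hull enters through its inequalities at angles \<open>\<phi>\<close> below
  \<open>pi / 2\<close>; doubling the angle turns them into those of a ball of twice the radius. The
  obstacle for the bump is that pairs with nearly equal base points are nearly extremal: as
  \<open>\<phi>\<close> approaches \<open>pi / 2\<close>, the available slack over the flat part is
  only of order \<open>cos \<phi>\<close>. The displacement, however, enters multiplied by
  \<open>sin (2 * \<phi>) \<le> 2 * cos \<phi>\<close>. For slope \<open>r / 4\<close> and base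
  distance \<open>d\<close> the cost is at most \<open>r * d * cos \<phi> / 2\<close>, a product of
  two small quantities. Against it stand \<open>d\<^sup>2 / 4\<close> from \<open>arc_defect\<close>
  and \<open>r\<^sup>2 * (cos \<phi>)\<^sup>2 / 4\<close> from the slack, and the
  arithmetic-geometric mean inequality closes the gap. This fixes the slope. When \<open>d\<close>
  is too small for the bound on the defect, the slack alone pays.\<close>

section \<open>Absolutely continuous curves\<close>

text \<open>The intervals of a tagged division are indexed by pairs of a tag and an interval, those
  of the definition by naturals; a bijection renumbers them.\<close>

lemma abs_continuous_on_finite_family:
  assumes "abs_continuous_on a b g" and "0 < \<epsilon>"
  shows "\<exists>\<delta>>0. \<forall>(I::'i set) u v. finite I \<longrightarrow> (\<forall>i\<in>I. a \<le> u i \<and> u i \<le> v i \<and> v i \<le> b) \<longrightarrow>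
           disjoint_family_on (\<lambda>i. {u i<..<v i}) I \<longrightarrow> (\<Sum>i\<in>I. v i - u i) < \<delta> \<longrightarrow>
           (\<Sum>i\<in>I. dist (g (u i)) (g (v i))) < \<epsilon>"
proof -
  obtain \<delta> where "0 < \<delta>" and \<delta>: "\<And>(m::nat) u v. (\<forall>i<m. a \<le> u i \<and> u i \<le> v i \<and> v i \<le> b) \<Longrightarrow>
        disjoint_family_on (\<lambda>i. {u i<..<v i}) {..<m} \<Longrightarrow> (\<Sum>i<m. v i - u i) < \<delta> \<Longrightarrow>
        (\<Sum>i<m. dist (g (u i)) (g (v i))) < \<epsilon>"
    using assms unfolding abs_continuous_on_def by meson
  show ?thesis
  proof (intro exI[of _ \<delta>] conjI allI impI \<open>0 < \<delta>\<close>)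
    fix I :: "'i set" and u v
    assume "finite I" and uv: "\<forall>i\<in>I. a \<le> u i \<and> u i \<le> v i \<and> v i \<le> b"
      and dis: "disjoint_family_on (\<lambda>i. {u i<..<v i}) I" and small: "(\<Sum>i\<in>I. v i - u i) < \<delta>"
    obtain h where h: "bij_betw h {..<card I} I"
      using ex_bij_betw_nat_finite[OF \<open>finite I\<close>] by (metis lessThan_atLeast0)
    have sum_h: "(\<Sum>i<card I. F (h i)) = (\<Sum>i\<in>I. F i)" for F :: "'i \<Rightarrow> real"
      using sum.reindex_bij_betw[OF h] .
    have "disjoint_family_on (\<lambda>i. {(u \<circ> h) i<..<(v \<circ> h) i}) {..<card I}"
      using dis h unfolding disjoint_family_on_def bij_betw_def inj_on_def
      by (smt (verit, best) comp_apply image_eqI)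
    moreover have "\<forall>i<card I. a \<le> (u \<circ> h) i \<and> (u \<circ> h) i \<le> (v \<circ> h) i \<and> (v \<circ> h) i \<le> b"
      using uv h by (auto simp: bij_betw_def)
    ultimately have "(\<Sum>i<card I. dist (g ((u \<circ> h) i)) (g ((v \<circ> h) i))) < \<epsilon>"
      using small sum_h[of "\<lambda>i. v i - u i"] by (intro \<delta>) auto
    then show "(\<Sum>i\<in>I. dist (g (u i)) (g (v i))) < \<epsilon>"
      by (simp add: sum_h[of "\<lambda>i. dist (g (u i)) (g (v i))"])
  qed
qed

text \<open>
  A gauge that is controlled by the derivative off the exceptional set \<open>N\<close> and confines the
  intervals tagged in \<open>N\<close> to an open set of small measure, where absolute continuity applies.
\<close>

theorem fundamental_theorem_of_calculus_abs_continuous: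
  fixes f :: "real \<Rightarrow> 'a::banach"
  assumes "a \<le> b" and ac: "abs_continuous_on a b f"
    and deriv: "AE s in lebesgue. s \<in> {a..b} \<longrightarrow> (f has_vector_derivative f' s) (at s)"
  shows "(f' has_integral (f b - f a)) {a..b}"
proof -
  define N where "N = {s \<in> {a..b}. \<not> (f has_vector_derivative f' s) (at s)}"
  have negN: "negligible N"
  proof -
    obtain N' where "N' \<in> null_sets lebesgue"
      "{s \<in> space lebesgue. \<not> (s \<in> {a..b} \<longrightarrow> (f has_vector_derivative f' s) (at s))} \<subseteq> N'"
      using deriv unfolding eventually_ae_filter by blast
    then show ?thesis
      by (intro negligible_subset[of N' N]) (auto simp: negligible_iff_null_sets N_def)
  qed
  \<comment> \<open>With the integrand 0 on \<open>N\<close>, the intervals tagged in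
    \<open>N\<close> contribute only increments of \<open>f\<close>, whose sum absolute continuity
    controls.\<close>
  define F where "F s = (if s \<in> N then 0 else f' s)" for s
  have "(F has_integral (f b - f a)) {a..b}"
    unfolding has_integral_real
  proof (intro allI impI)
    fix e :: real assume "0 < e"
    obtain \<delta> where "0 < \<delta>" and \<delta>: "\<forall>(I::(real \<times> real set) set) u v. finite I \<longrightarrow>
           (\<forall>i\<in>I. a \<le> u i \<and> u i \<le> v i \<and> v i \<le> b) \<longrightarrow>
           disjoint_family_on (\<lambda>i. {u i<..<v i}) I \<longrightarrow> (\<Sum>i\<in>I. v i - u i) < \<delta> \<longrightarrow>
           (\<Sum>i\<in>I. dist (f (u i)) (f (v i))) < e / 2"
      using abs_continuous_on_finite_family[where 'i = "real \<times> real set", OF ac half_gt_zero[OF \<open>0 < e\<close>]]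
      by blast
    obtain U where U: "open U" "N \<subseteq> U" "(U - N) \<in> lmeasurable" "emeasure lebesgue (U - N) < ennreal \<delta>"
      using sets_lebesgue_outer_open[OF _ \<open>0 < \<delta>\<close>, of N] negN negligible_imp_sets by blast
    have emU: "emeasure lebesgue U < ennreal \<delta>"
    proof -
      have "emeasure lebesgue U \<le> emeasure lebesgue ((U - N) \<union> N)"
        using U negN by (intro emeasure_mono) (auto simp: negligible_imp_sets fmeasurableD)
      also have "\<dots> = emeasure lebesgue (U - N)"
        using negN U by (intro emeasure_Un_null_set) (auto simp: negligible_iff_null_sets fmeasurableD)
      finally show ?thesis using U by simp
    qed
    \<comment> \<open>The tags outside \<open>N\<close> contribute at most
      \<open>c * (b - a) \<le> e / 2\<close>; the added 1 keeps the denominator positive when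
      \<open>a = b\<close>.\<close>
    define c where "c = e / 2 / (b - a + 1)"
    have "0 < c" using \<open>0 < e\<close> \<open>a \<le> b\<close> by (simp add: c_def)
    have ex: "\<exists>d>0. x \<in> {a..b} \<longrightarrow> (if x \<in> N then ball x d \<subseteq> U
         else (\<forall>y. norm (y - x) < d \<longrightarrow> norm (f y - f x - (y - x) *\<^sub>R f' x) \<le> c * norm (y - x)))" for x
    proof (cases "x \<in> N")
      case True
      then obtain d where "0 < d" "ball x d \<subseteq> U" using U(1,2) by (meson open_contains_ball subsetD)
      then show ?thesis using True by auto
    next
      case False
      show ?thesis
      proof (cases "x \<in> {a..b}")
        case True
        then have "(f has_derivative (\<lambda>h. h *\<^sub>R f' x)) (at x)"
          using False by (auto simp: N_def has_vector_derivative_def)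
        then have "\<exists>d>0. \<forall>y. norm (y - x) < d \<longrightarrow> norm (f y - f x - (y - x) *\<^sub>R f' x) \<le> c * norm (y - x)"
          using \<open>0 < c\<close> unfolding has_derivative_at_alt by blast
        then show ?thesis
          using False by (simp only: if_False) blast
      qed (auto intro: exI[of _ 1])
    qed
    then have "\<exists>d. \<forall>x. 0 < d x \<and> (x \<in> {a..b} \<longrightarrow> (if x \<in> N then ball x (d x) \<subseteq> U
         else (\<forall>y. norm (y - x) < d x \<longrightarrow> norm (f y - f x - (y - x) *\<^sub>R f' x) \<le> c * norm (y - x))))"
      by (intro choice allI)
    then obtain d where d_all: "\<forall>x. 0 < d x \<and> (x \<in> {a..b} \<longrightarrow> (if x \<in> N then ball x (d x) \<subseteq> U
         else (\<forall>y. norm (y - x) < d x \<longrightarrow> norm (f y - f x - (y - x) *\<^sub>R f' x) \<le> c * norm (y - x))))" ..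
    have d: "\<And>x. 0 < d x" "\<And>x. x \<in> {a..b} \<Longrightarrow> x \<in> N \<Longrightarrow> ball x (d x) \<subseteq> U"
      "\<And>x y. x \<in> {a..b} \<Longrightarrow> x \<notin> N \<Longrightarrow> norm (y - x) < d x \<Longrightarrow>
          norm (f y - f x - (y - x) *\<^sub>R f' x) \<le> c * norm (y - x)"
      using d_all by metis+
    show "\<exists>\<gamma>. gauge \<gamma> \<and> (\<forall>\<D>. \<D> tagged_division_of {a..b} \<and> \<gamma> fine \<D> \<longrightarrow>
        norm ((\<Sum>(x,k)\<in>\<D>. measure lborel k *\<^sub>R F x) - (f b - f a)) < e)"
    proof (intro exI conjI allI impI)
      show "gauge (\<lambda>x. ball x (d x))"
        using d(1) gauge_ball_dependent by blast
      fix p assume "p tagged_division_of {a..b} \<and> (\<lambda>x. ball x (d x)) fine p"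
      then have ptag: "p tagged_division_of {a..b}" and fine: "(\<lambda>x. ball x (d x)) fine p" by auto
      note p = tagged_division_ofD[OF ptag]
      have ba: "b - a = (\<Sum>(x,K)\<in>p. Sup K - Inf K)" "f b - f a = (\<Sum>(x,K)\<in>p. f(Sup K) - f(Inf K))"
        using additive_tagged_division_1[OF \<open>a \<le> b\<close> ptag, of "\<lambda>x. x"]
          additive_tagged_division_1[OF \<open>a \<le> b\<close> ptag, of f] by auto
      define p1 where "p1 = {q \<in> p. fst q \<in> N}"
      have K: "\<exists>u v. K = {u..v} \<and> u \<le> v \<and> Inf K = u \<and> Sup K = v \<and> measure lborel K = v - u \<and> x \<in> {u..v} \<and> a \<le> u \<and> v \<le> b"
        if q: "(x, K) \<in> p" for x K
      proof -
        obtain u v where uv: "K = cbox u v" using p(4)[OF q] by blast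
        moreover have "x \<in> K" "K \<subseteq> {a..b}" using p(2,3)[OF q] by auto
        ultimately have "u \<le> v" "x \<in> {u..v}" "a \<le> u" "v \<le> b" by auto
        with uv show ?thesis by (intro exI[of _ u] exI[of _ v]) auto
      qed
      have out: "norm (measure lborel K *\<^sub>R F x - (f (Sup K) - f (Inf K))) \<le> c * (Sup K - Inf K)"
        if q: "(x, K) \<in> p" "x \<notin> N" for x K
      proof -
        obtain u v where uv: "K = {u..v}" "u \<le> v" "Inf K = u" "Sup K = v" "measure lborel K = v - u" "x \<in> {u..v}" "a \<le> u" "v \<le> b"
          using K q by blast
        have "K \<subseteq> ball x (d x)" using fine q by (auto simp: fine_def)
        then have "norm (u - x) < d x" "norm (v - x) < d x"
          using uv(1,2) by (auto simp: subset_iff dist_real_def abs_minus_commute)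
        then have *: "norm (f u - f x - (u - x) *\<^sub>R f' x) \<le> c * norm (u - x)"
          "norm (f v - f x - (v - x) *\<^sub>R f' x) \<le> c * norm (v - x)"
          using d(3)[of x u] d(3)[of x v] q(2) uv by auto
        \<comment> \<open>Straddling: the tag lies between \<open>u\<close> and \<open>v\<close>, so
          the two one-sided errors add up to \<open>c * (v - u)\<close>.\<close>
        have "norm ((v - u) *\<^sub>R f' x - (f v - f u)) =
            norm ((f u - f x - (u - x) *\<^sub>R f' x) - (f v - f x - (v - x) *\<^sub>R f' x))"
          by (auto simp: algebra_simps)
        also have "\<dots> \<le> c * norm (u - x) + c * norm (v - x)"
          by (rule order_trans[OF norm_triangle_ineq4 add_mono[OF *]])
        also have "\<dots> = c * (v - u)"
          using uv(6) by (auto simp: algebra_simps)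
        finally show ?thesis using uv q by (simp add: F_def)
      qed
      have p1fin: "finite p1" and p1p: "p1 \<subseteq> p" using p(1) by (auto simp: p1_def)
      have disj: "disjoint_family_on (\<lambda>q. {Inf (snd q)<..<Sup (snd q)}) p1"
        unfolding disjoint_family_on_def
      proof (intro ballI impI)
        fix q q' assume q: "q \<in> p1" "q' \<in> p1" "q \<noteq> q'"
        obtain x k x' k' where qs: "q = (x, k)" "q' = (x', k')" by (cases q, cases q')
        have inp: "(x, k) \<in> p" "(x', k') \<in> p" using q(1,2) p1p unfolding qs by blast+
        have "interior k \<inter> interior k' = {}"
          by (rule p(5)[OF inp]) (use q(3) qs in simp)
        moreover have "interior L = {Inf L<..<Sup L}" if "(y, L) \<in> p" for y L
          using K[OF that] interior_atLeastAtMost_real by metis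
        ultimately show "{Inf (snd q)<..<Sup (snd q)} \<inter> {Inf (snd q')<..<Sup (snd q')} = {}"
          using inp by (simp add: qs)
      qed
      have Kq: "a \<le> Inf (snd q)" "Inf (snd q) \<le> Sup (snd q)" "Sup (snd q) \<le> b" if "q \<in> p1" for q
        using K[of "fst q" "snd q"] that p1p by auto
      have "(\<Sum>q\<in>p1. Sup (snd q) - Inf (snd q)) < \<delta>"
      proof -
        have "ennreal (\<Sum>q\<in>p1. Sup (snd q) - Inf (snd q)) = (\<Sum>q\<in>p1. ennreal (Sup (snd q) - Inf (snd q)))"
          using Kq by (subst sum_ennreal) auto
        also have "\<dots> = (\<Sum>q\<in>p1. emeasure lebesgue {Inf (snd q)<..<Sup (snd q)})"
          using Kq by (intro sum.cong) auto
        also have "\<dots> = emeasure lebesgue (\<Union>q\<in>p1. {Inf (snd q)<..<Sup (snd q)})"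
          using disj p1fin by (intro sum_emeasure) auto
        also have "\<dots> \<le> emeasure lebesgue U"
        proof (intro emeasure_mono UN_least)
          fix q assume "q \<in> p1"
          then obtain x k where q: "q = (x, k)" "(x, k) \<in> p" "x \<in> N" unfolding p1_def by (cases q) simp
          have "{Inf k<..<Sup k} \<subseteq> k"
            using K[OF q(2)] greaterThanLessThan_subseteq_atLeastAtMost_iff order_refl by metis
          also have "\<dots> \<subseteq> ball x (d x)" using fine q by (auto simp: fine_def)
          also have "\<dots> \<subseteq> U" using d(2)[of x] q by (auto simp: N_def)
          finally show "{Inf (snd q)<..<Sup (snd q)} \<subseteq> U" using q by simp
        qed (use U in auto)
        finally have "ennreal (\<Sum>q\<in>p1. Sup (snd q) - Inf (snd q)) < ennreal \<delta>"
          using emU by (rule le_less_trans)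
        moreover have "0 \<le> (\<Sum>q\<in>p1. Sup (snd q) - Inf (snd q))"
          using Kq by (intro sum_nonneg) simp
        ultimately show ?thesis by (simp add: ennreal_less_iff)
      qed
      then have in1: "(\<Sum>q\<in>p1. dist (f (Inf (snd q))) (f (Sup (snd q)))) < e / 2"
        using Kq by (intro \<delta>[rule_format, OF p1fin _ disj]) auto
      have "norm ((\<Sum>(x,k)\<in>p. measure lborel k *\<^sub>R F x) - (f b - f a))
          = norm (\<Sum>q\<in>p. measure lborel (snd q) *\<^sub>R F (fst q) - (f (Sup (snd q)) - f (Inf (snd q))))"
        unfolding ba by (simp add: split_def sum_subtractf)
      also have "\<dots> \<le> (\<Sum>q\<in>p. norm (measure lborel (snd q) *\<^sub>R F (fst q) - (f (Sup (snd q)) - f (Inf (snd q)))))"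
        by (rule norm_sum)
      also have "\<dots> \<le> (\<Sum>q\<in>p. c * (Sup (snd q) - Inf (snd q)) +
           (if q \<in> p1 then dist (f (Inf (snd q))) (f (Sup (snd q))) else 0))"
      proof (rule sum_mono)
        fix q assume "q \<in> p"
        obtain x k where [simp]: "q = (x, k)" by fastforce
        have "0 \<le> c * (Sup k - Inf k)" using K[of x k] \<open>q \<in> p\<close> \<open>0 < c\<close> by auto
        then show "norm (measure lborel (snd q) *\<^sub>R F (fst q) - (f (Sup (snd q)) - f (Inf (snd q)))) \<le>
          c * (Sup (snd q) - Inf (snd q)) + (if q \<in> p1 then dist (f (Inf (snd q))) (f (Sup (snd q))) else 0)"
          using out[of x k] \<open>q \<in> p\<close>
          by (cases "x \<in> N") (simp_all add: p1_def F_def dist_norm norm_minus_commute[of "f (Sup k)"])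
      qed
      also have "\<dots> = c * (b - a) + (\<Sum>q\<in>p1. dist (f (Inf (snd q))) (f (Sup (snd q))))"
      proof -
        have "(\<Sum>q\<in>p. if q \<in> p1 then dist (f (Inf (snd q))) (f (Sup (snd q))) else 0)
            = (\<Sum>q\<in>p1. dist (f (Inf (snd q))) (f (Sup (snd q))))"
          using p(1) p1p by (intro sum.mono_neutral_cong_right) auto
        moreover have "(\<Sum>q\<in>p. c * (Sup (snd q) - Inf (snd q))) = c * (b - a)"
          unfolding ba(1) by (simp add: split_def sum_distrib_left)
        ultimately show ?thesis by (simp add: sum.distrib)
      qed
      also have "\<dots> < e"
      proof -
        have "c * (b - a) \<le> e / 2"
          using \<open>0 < e\<close> \<open>a \<le> b\<close> by (simp add: c_def field_simps)
        with in1 show ?thesis by linarith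
      qed
      finally show "norm ((\<Sum>(x,k)\<in>p. measure lborel k *\<^sub>R F x) - (f b - f a)) < e" .
    qed
  qed
  moreover have "\<And>x. x \<in> {a..b} - N \<Longrightarrow> f' x = F x"
    by (simp add: F_def)
  ultimately show ?thesis
    using has_integral_spike[OF negN, of "{a..b}" f' F] by metis
qed

section \<open>Horizontal curves\<close>

text \<open>The symplectic form of the group law. It is the imaginary part of the Hermitian product
  whose real part is \<open>inner\<close>, so complex scalars mix the two.\<close>

definition symp :: "complex ^ 'n \<Rightarrow> complex ^ ('n::finite) \<Rightarrow> real" where
  "symp z w = (\<Sum>j\<in>UNIV. Im (z $ j * cnj (w $ j)))"

lemma inner_complex_vec: "inner z w = (\<Sum>j\<in>UNIV. Re (z $ j * cnj (w $ j)))"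
  for z w :: "complex ^ ('n::finite)"
  by (simp add: inner_vec_def inner_complex_def)

lemma inner_complex_scale: "inner (c *s z) w = Re c * inner z w - Im c * symp z w"
  for z w :: "complex ^ ('n::finite)"
  unfolding inner_complex_vec symp_def
  by (simp add: sum_distrib_left sum_subtractf[symmetric] algebra_simps)

lemma norm_complex_scale: "norm (c *s z) = cmod c * norm z"
  for z :: "complex ^ ('n::finite)"
  by (simp add: norm_vec_def norm_mult L2_set_right_distrib)

lemma symp_commute: "symp w z = - symp z w"
  by (simp add: symp_def sum_negf[symmetric] algebra_simps)

lemma symp_self [simp]: "symp z z = 0"
  using symp_commute[of z z] by simp

lemma symp_zero [simp]: "symp 0 z = 0" "symp z 0 = 0"
  by (simp_all add: symp_def)

lemma symp_add_left: "symp (x + y) z = symp x z + symp y z"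
  by (simp add: symp_def algebra_simps sum.distrib sum_subtractf)

lemma symp_add_right: "symp z (x + y) = symp z x + symp z y"
  by (simp add: symp_def algebra_simps sum.distrib sum_subtractf)

lemma symp_minus [simp]: "symp (- x) z = - symp x z" "symp z (- x) = - symp z x"
  by (simp_all add: symp_def sum_negf[symmetric] algebra_simps)

lemma symp_diff_left: "symp (x - y) z = symp x z - symp y z"
  using symp_add_left[of x "- y"] by simp

lemma symp_diff_right: "symp z (x - y) = symp z x - symp z y"
  using symp_add_right[of z x "- y"] by simp

lemma symp_scaleR [simp]: "symp (r *\<^sub>R x) z = r * symp x z" "symp z (r *\<^sub>R x) = r * symp z x"
  by (simp_all add: symp_def sum_distrib_left algebra_simps)

text \<open>Cauchy-Schwarz for \<open>Complex \<alpha> (- \<beta>) *s z\<close> and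
  \<open>w\<close>. The sharp constant matters: for \<open>\<alpha> = cot y\<close> and
  \<open>\<beta> = \<plusminus> 1\<close> it is \<open>1 / sin y\<close>, exactly what the
  calibration needs.\<close>

lemma inner_symp_bound:
  fixes z w :: "complex ^ ('n::finite)"
  shows "\<bar>\<alpha> * inner z w + \<beta> * symp z w\<bar> \<le> sqrt (\<alpha>\<^sup>2 + \<beta>\<^sup>2) * norm z * norm w"
proof -
  have "\<alpha> * inner z w + \<beta> * symp z w = inner (Complex \<alpha> (- \<beta>) *s z) w"
    by (simp add: inner_complex_scale)
  then have "\<bar>\<alpha> * inner z w + \<beta> * symp z w\<bar> \<le> norm (Complex \<alpha> (- \<beta>) *s z) * norm w"
    using Cauchy_Schwarz_ineq2 by metis
  then show ?thesis
    by (simp add: norm_complex_scale cmod_def)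
qed

lemma abs_symp_le: "\<bar>symp z w\<bar> \<le> norm z * norm w"
  using inner_symp_bound[of 0 z w 1] by simp

lemma bounded_bilinear_symp: "bounded_bilinear symp"
proof
  show "\<exists>K. \<forall>a b. norm (symp a b) \<le> norm a * norm b * K"
    by (rule exI[of _ 1]) (simp add: abs_symp_le)
qed (simp_all add: symp_add_left symp_add_right)

lemmas continuous_on_symp [continuous_intros] = bounded_bilinear.continuous_on[OF bounded_bilinear_symp]

lemma heis_mult_symp: "heis_mult p q = (fst p + fst q, snd p + snd q + 2 * symp (fst p) (fst q))"
  by (simp add: heis_mult_def symp_def)

lemma heis_vert_symp: "heis_vert p v = snd v - 2 * symp (fst p) (fst v)"
  by (simp add: heis_vert_def symp_def sum_distrib_left sum_subtractf[symmetric] algebra_simps)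

lemma heis_metric_self: "heis_metric p v v = (norm (fst v))\<^sup>2 + (heis_vert p v)\<^sup>2"
  unfolding heis_metric_def power2_norm_eq_inner inner_vec_def
  by (simp add: inner_complex_def power2_eq_square)

lemma horizontal_iff_heis_vert:
  "v \<in> span (range (\<lambda>j. heis_X j p) \<union> range (\<lambda>j. heis_Y j p)) \<longleftrightarrow> heis_vert p v = 0"
proof
  assume "v \<in> span (range (\<lambda>j. heis_X j p) \<union> range (\<lambda>j. heis_Y j p))"
  then show "heis_vert p v = 0"
  proof (induction rule: span_induct)
    case base
    show ?case
      by (auto simp: subspace_def heis_vert_symp symp_add_right algebra_simps)
  next
    case (step x)
    then show ?case by (auto simp: heis_vert_frame)
  qed
next
  assume "heis_vert p v = 0"
  then have "v = (\<Sum>j\<in>UNIV. Re (fst v $ j) *\<^sub>R heis_X j p + Im (fst v $ j) *\<^sub>R heis_Y j p)"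
    using heis_frame_expansion[of v p] by simp
  also have "\<dots> \<in> span (range (\<lambda>j. heis_X j p) \<union> range (\<lambda>j. heis_Y j p))"
    by (intro span_sum span_add span_scale) (auto intro: span_base)
  finally show "v \<in> span (range (\<lambda>j. heis_X j p) \<union> range (\<lambda>j. heis_Y j p))" .
qed

lemma abs_continuous_on_subinterval:
  "abs_continuous_on a b g \<Longrightarrow> a \<le> c \<Longrightarrow> d \<le> b \<Longrightarrow> abs_continuous_on c d g"
  unfolding abs_continuous_on_def by (meson order_trans)

text \<open>
  \<open>L\<close> is the length function of the curve. The last estimate is the discrete form of
  \<open>dt = 2 symp z dz\<close>, since \<open>symp z z = 0\<close>.
\<close>

lemma horizontal_curve_increments:
  fixes g :: "real \<Rightarrow> 'n::finite heis"
  assumes "a \<le> b" and hor: "horizontal_curve a b g" and len: "riem_length a b g \<le> ennreal l" and "0 \<le> l"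
  obtains L where "continuous_on {a..b} L" "L a = 0" "L b \<le> l"
    "\<And>u v. a \<le> u \<Longrightarrow> u \<le> v \<Longrightarrow> v \<le> b \<Longrightarrow> norm (fst (g v) - fst (g u)) \<le> L v - L u"
    "\<And>u v. a \<le> u \<Longrightarrow> u \<le> v \<Longrightarrow> v \<le> b \<Longrightarrow>
       \<bar>snd (g v) - snd (g u) - 2 * symp (fst (g u)) (fst (g v))\<bar> \<le> 2 * (L v - L u)\<^sup>2"
proof -
  define G where "G s = vector_derivative g (at s)" for s
  define h where "h s = fst (G s)" for s
  have ac: "abs_continuous_on a b g"
    and ae: "AE s in lebesgue. s \<in> {a..b} \<longrightarrow> g differentiable (at s) \<and> heis_vert (g s) (G s) = 0"
    using hor unfolding horizontal_curve_def G_def horizontal_iff_heis_vert by auto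
  have G_int: "(G has_integral (g v - g u)) {u..v}" if "a \<le> u" "u \<le> v" "v \<le> b" for u v
  proof (rule fundamental_theorem_of_calculus_abs_continuous)
    show "abs_continuous_on u v g"
      using abs_continuous_on_subinterval[OF ac] that by simp
    show "AE s in lebesgue. s \<in> {u..v} \<longrightarrow> (g has_vector_derivative G s) (at s)"
      using ae by (rule AE_mp) (use that in \<open>auto simp: G_def vector_derivative_works[symmetric]\<close>)
  qed fact
  have h_int: "(h has_integral (fst (g v) - fst (g u))) {u..v}" if "a \<le> u" "u \<le> v" "v \<le> b" for u v
    using has_integral_linear[OF G_int[OF that] bounded_linear_fst] by (simp add: o_def h_def[abs_def])
  have G_int2: "((\<lambda>s. snd (G s)) has_integral (snd (g v) - snd (g u))) {u..v}"
    if "a \<le> u" "u \<le> v" "v \<le> b" for u v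
    using has_integral_linear[OF G_int[OF that] bounded_linear_snd] by (simp add: o_def)
  have h_meas: "h \<in> borel_measurable (lebesgue_on {a..b})"
    using h_int[of a b] \<open>a \<le> b\<close> by (intro integrable_imp_measurable) (auto simp: integrable_on_def)
  then have h_meas': "(\<lambda>s. indicator {a..b} s *\<^sub>R h s) \<in> borel_measurable lebesgue"
    by (subst borel_measurable_restrict_space_iff[symmetric]) auto
  have len_h: "(\<integral>\<^sup>+s. ennreal (norm (indicator {a..b} s *\<^sub>R h s)) \<partial>lebesgue) = riem_length a b g"
    unfolding riem_length_def
  proof (rule nn_integral_cong_AE)
    show "AE s in lebesgue. ennreal (norm (indicator {a..b} s *\<^sub>R h s)) =
       ennreal (sqrt (heis_metric (g s) (vector_derivative g (at s)) (vector_derivative g (at s)))) * indicator {a..b} s"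
      using ae by (rule AE_mp) (auto simp: heis_metric_self h_def G_def indicator_def)
  qed
  \<comment> \<open>Integrability comes from finite length: a horizontal velocity has Riemannian
    norm \<open>norm (h s)\<close>.\<close>
  have integ: "integrable lebesgue (\<lambda>s. indicator {a..b} s *\<^sub>R h s)"
    unfolding integrable_iff_bounded len_h using h_meas' len by (auto simp: le_less_trans)
  then have h_abs: "h absolutely_integrable_on {a..b}"
    by (simp add: set_integrable_def)
  define L where "L s = integral {a..s} (\<lambda>x. norm (h x))" for s
  have nh: "(\<lambda>x. norm (h x)) integrable_on {u..v}" if "a \<le> u" "v \<le> b" for u v
    using h_abs that by (auto simp: absolutely_integrable_on_def intro: integrable_on_subinterval)
  have L_diff: "integral {u..v} (\<lambda>x. norm (h x)) = L v - L u" if "a \<le> u" "u \<le> v" "v \<le> b" for u v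
    using Henstock_Kurzweil_Integration.integral_combine[of a u v "\<lambda>x. norm (h x)"] that nh[of a v]
    unfolding L_def by simp
  have L_z: "norm (fst (g v) - fst (g u)) \<le> L v - L u" if "a \<le> u" "u \<le> v" "v \<le> b" for u v
  proof -
    have "norm (integral {u..v} h) \<le> integral {u..v} (\<lambda>x. norm (h x))"
      using h_int[OF that] nh[of u v] that
      by (intro integral_norm_bound_integral) (auto simp: integrable_on_def)
    then show ?thesis
      using h_int[OF that] L_diff[OF that] by (simp add: integral_unique)
  qed
  show thesis
  proof (rule that[of L])
    show "continuous_on {a..b} L"
      unfolding L_def by (rule indefinite_integral_continuous_1) (use nh in auto)
    show "L a = 0" by (simp add: L_def)
    have "ennreal (L b) = riem_length a b g"
    proof -
      have "L b = (LINT s|lebesgue. norm (indicator {a..b} s *\<^sub>R h s))"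
        unfolding L_def
        using set_lebesgue_integral_eq_integral(2)[OF absolutely_integrable_norm[OF h_abs]]
        by (simp add: set_lebesgue_integral_def o_def abs_mult)
      then show ?thesis
        unfolding len_h[symmetric] using integrable_norm[OF integ] by (subst nn_integral_eq_integral) auto
    qed
    then show "L b \<le> l" using len \<open>0 \<le> l\<close> by (metis ennreal_le_iff)
  next
    fix u v assume uv: "a \<le> u" "u \<le> v" "v \<le> b"
    show "norm (fst (g v) - fst (g u)) \<le> L v - L u" using L_z[OF uv] .
    \<comment> \<open>The integrand is reset to 0 on the null set of non-horizontal velocities,
      because the norm bound below is required at every point.\<close>
    define F where "F s = (if heis_vert (g s) (G s) = 0 then snd (G s) - 2 * symp (fst (g u)) (h s) else 0)" for s
    have "((\<lambda>s. snd (G s) - 2 * symp (fst (g u)) (h s)) has_integral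
        (snd (g v) - snd (g u) - 2 * symp (fst (g u)) (fst (g v) - fst (g u)))) {u..v}"
      using has_integral_linear[OF h_int[OF uv] bounded_bilinear.bounded_linear_right[OF bounded_bilinear_symp, of "fst (g u)"]]
      by (intro has_integral_diff G_int2[OF uv] has_integral_mult_right) (auto simp: o_def)
    then have F_int: "(F has_integral (snd (g v) - snd (g u) - 2 * symp (fst (g u)) (fst (g v)))) {u..v}"
    proof -
      obtain N where "N \<in> null_sets lebesgue" and
        N: "{s \<in> space lebesgue. \<not> (s \<in> {a..b} \<longrightarrow> g differentiable (at s) \<and> heis_vert (g s) (G s) = 0)} \<subseteq> N"
        using ae unfolding eventually_ae_filter by blast
      then have "negligible N" by (simp add: negligible_iff_null_sets)
      moreover have "F s = snd (G s) - 2 * symp (fst (g u)) (h s)" if s: "s \<in> {u..v} - N" for s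
      proof -
        have "s \<in> {a..b}" "s \<notin> N" using s uv by auto
        then have "heis_vert (g s) (G s) = 0" using subsetD[OF N, of s] by auto
        then show ?thesis by (simp add: F_def)
      qed
      ultimately show ?thesis
        using \<open>(_ has_integral _) {u..v}\<close> has_integral_spike[of N "{u..v}" F "\<lambda>s. snd (G s) - 2 * symp (fst (g u)) (h s)"]
        by (simp add: symp_diff_right)
    qed
    have "norm (integral {u..v} F) \<le> integral {u..v} (\<lambda>s. 2 * (L v - L u) * norm (h s))"
    proof (rule integral_norm_bound_integral)
      show "F integrable_on {u..v}" using F_int by (auto simp: integrable_on_def)
      show "(\<lambda>s. 2 * (L v - L u) * norm (h s)) integrable_on {u..v}"
        using nh[of u v] uv by (intro integrable_on_mult_right) auto
      fix s assume s: "s \<in> {u..v}"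
      have mono: "norm (fst (g s) - fst (g u)) \<le> L v - L u"
      proof -
        have "0 \<le> L v - L s" using L_z[of s v] s uv by (meson atLeastAtMost_iff norm_ge_zero order_trans)
        then show ?thesis using L_z[of u s] s uv by auto
      qed
      show "norm (F s) \<le> 2 * (L v - L u) * norm (h s)"
      proof (cases "heis_vert (g s) (G s) = 0")
        case True
        then have "F s = 2 * symp (fst (g s) - fst (g u)) (h s)"
          by (simp add: F_def heis_vert_symp h_def symp_diff_left)
        then have "norm (F s) \<le> 2 * (norm (fst (g s) - fst (g u)) * norm (h s))"
          using abs_symp_le[of "fst (g s) - fst (g u)" "h s"] by simp
        also have "\<dots> \<le> 2 * ((L v - L u) * norm (h s))"
          using mono by (intro mult_left_mono mult_right_mono) auto
        finally show ?thesis by (simp only: mult.assoc)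
      next
        case False
        moreover have "0 \<le> L v - L u" using mono norm_ge_zero order_trans by blast
        ultimately show ?thesis by (simp add: F_def)
      qed
    qed
    moreover have "integral {u..v} (\<lambda>s. 2 * (L v - L u) * norm (h s)) = 2 * (L v - L u) * (L v - L u)"
      using L_diff[OF uv] by simp
    ultimately show "\<bar>snd (g v) - snd (g u) - 2 * symp (fst (g u)) (fst (g v))\<bar> \<le> 2 * (L v - L u)\<^sup>2"
      by (simp only: integral_unique[OF F_int] real_norm_def power2_eq_square mult.assoc)
  qed
qed

section \<open>Lower bounds for the Carnot-Caratheodory distance\<close>

text \<open>Bisection at points where \<open>L\<close>, not the parameter, takes its mean value:
  each round halves the quadratic bound, and in the limit the increment of \<open>P\<close> is at
  most 0.\<close>

lemma increment_square_imp_le: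
  fixes P L :: "real \<Rightarrow> real"
  assumes "a \<le> b" "continuous_on {a..b} L"
    and incr: "\<And>u v. a \<le> u \<Longrightarrow> u \<le> v \<Longrightarrow> v \<le> b \<Longrightarrow> L u \<le> L v \<and> P v - P u \<le> K * (L v - L u)\<^sup>2"
  shows "P b \<le> P a"
proof -
  have halve: "P v - P u \<le> K * (L v - L u)\<^sup>2 / 2 ^ k" if "a \<le> u" "u \<le> v" "v \<le> b" for u v k
    using that
  proof (induction k arbitrary: u v)
    case 0
    then show ?case using incr[of u v] by simp
  next
    case (Suc k)
    have "continuous_on {u..v} L"
      using assms(2) by (rule continuous_on_subset) (use Suc.prems in auto)
    then obtain m where m: "u \<le> m" "m \<le> v" "L m = (L u + L v) / 2"
      using IVT'[of L u "(L u + L v) / 2" v] incr[of u v] Suc.prems by auto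
    have "P v - P u = (P v - P m) + (P m - P u)" by simp
    also have "\<dots> \<le> K * (L v - L m)\<^sup>2 / 2 ^ k + K * (L m - L u)\<^sup>2 / 2 ^ k"
      using m Suc.prems by (intro add_mono Suc.IH) auto
    also have "\<dots> = K * (L v - L u)\<^sup>2 / 2 ^ Suc k"
      unfolding m(3) by (simp add: field_simps power2_eq_square)
    finally show ?case .
  qed
  have lim: "(\<lambda>k. K * (L b - L a)\<^sup>2 * (1 / 2) ^ k) \<longlonglongrightarrow> K * (L b - L a)\<^sup>2 * 0"
    by (intro tendsto_mult_left LIMSEQ_realpow_zero) auto
  have "P b - P a \<le> K * (L b - L a)\<^sup>2 * (1 / 2) ^ k" for k
    using halve[of a b k] \<open>a \<le> b\<close> by (simp add: power_one_over)
  then have "P b - P a \<le> K * (L b - L a)\<^sup>2 * 0"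
    using LIMSEQ_le_const[OF lim] by blast
  then show ?thesis by simp
qed

text \<open>Expansion of \<open>cot\<close> to first order at the right end point. The mean value
  theorem yields an intermediate \<open>t\<close>; replacing it by \<open>y\<close> costs a
  quadratic error, since the squared sine changes by at most \<open>y - t\<close>.\<close>

lemma cot_diff_lower_bound:
  fixes m :: real
  assumes x: "0 < x" "x \<le> y" "y < pi" and "0 < m" and m: "\<And>t. x \<le> t \<Longrightarrow> t \<le> y \<Longrightarrow> m \<le> sin t"
  shows "(y - x) / (sin y)\<^sup>2 - (y - x)\<^sup>2 / m ^ 4 \<le> cot x - cot y"
proof (cases "x = y")
  case False
  then have "x < y" using x by simp
  have "(cot has_real_derivative - inverse ((sin t)\<^sup>2)) (at t)" if "x \<le> t" "t \<le> y" for t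
    using m[OF that] \<open>0 < m\<close> by (intro DERIV_cot) auto
  from MVT2[OF \<open>x < y\<close> this] obtain t where t: "x < t" "t < y" "cot y - cot x = (y - x) * - inverse ((sin t)\<^sup>2)"
    by auto
  have pos: "m \<le> sin t" "m \<le> sin y" using m[of t] m[of y] t by auto
  have "(sin y)\<^sup>2 - (sin t)\<^sup>2 = sin (y + t) * sin (y - t)"
  proof -
    have "sin (y + t) * sin (y - t) = (cos (2 * t) - cos (2 * y)) / 2"
      by (simp add: sin_times_sin)
    then show ?thesis by (simp only: cos_double_sin) simp
  qed
  note eq = this
  have "- (y - x) \<le> (sin y)\<^sup>2 - (sin t)\<^sup>2"
  proof -
    have "\<bar>sin (y + t) * sin (y - t)\<bar> \<le> 1 * \<bar>y - t\<bar>"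
      unfolding abs_mult by (intro mult_mono abs_sin_x_le_abs_x) auto
    then have "- (y - t) \<le> sin (y + t) * sin (y - t)"
      using t by (simp add: abs_le_iff)
    then show ?thesis unfolding eq using t by linarith
  qed
  have "(sin t)\<^sup>2 * (sin y)\<^sup>2 \<ge> m\<^sup>2 * m\<^sup>2"
    using pos \<open>0 < m\<close> by (intro mult_mono power_mono) auto
  then have "m ^ 4 \<le> (sin t)\<^sup>2 * (sin y)\<^sup>2" by (simp add: power2_eq_square power4_eq_xxxx)
  have "1 / (sin y)\<^sup>2 - 1 / (sin t)\<^sup>2 = ((sin t)\<^sup>2 - (sin y)\<^sup>2) / ((sin t)\<^sup>2 * (sin y)\<^sup>2)"
    using pos \<open>0 < m\<close> by (simp add: field_simps)
  also have "\<dots> \<le> (y - x) / ((sin t)\<^sup>2 * (sin y)\<^sup>2)"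
    using \<open>- (y - x) \<le> _\<close> by (intro divide_right_mono) auto
  also have "\<dots> \<le> (y - x) / m ^ 4"
    using \<open>m ^ 4 \<le> _\<close> \<open>0 < m\<close> \<open>x < y\<close> pos by (intro divide_left_mono mult_pos_pos) auto
  finally have "(y - x) * (1 / (sin y)\<^sup>2 - 1 / (sin t)\<^sup>2) \<le> (y - x) * ((y - x) / m ^ 4)"
    using \<open>x < y\<close> by (intro mult_left_mono) auto
  then show ?thesis
    using t(3) by (simp add: field_simps power2_eq_square)
qed simp

lemma sin_lower_bound_compact:
  fixes x y :: real
  assumes "0 < x" "x \<le> y" "y < pi"
  shows "\<exists>m>0. \<forall>t\<in>{x..y}. m \<le> sin t"
proof -
  have "continuous_on {x..y} sin" by (intro continuous_intros)
  then obtain t where t: "t \<in> {x..y}" "\<forall>s\<in>{x..y}. sin t \<le> sin s"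
    using continuous_attains_inf[of "{x..y}" sin] assms(2) by auto
  moreover have "0 < sin t" using t(1) assms by (intro sin_gt_zero) auto
  ultimately show ?thesis by blast
qed

lemma cot_le_inverse:
  fixes y :: real
  assumes "0 < y" "y < pi" shows "cot y \<le> 1 / y"
proof -
  have "sin 0 - 0 * cos 0 \<le> sin y - y * cos y"
  proof (rule DERIV_nonneg_imp_nondecreasing[where f = "\<lambda>x. sin x - x * cos x"])
    fix x assume "0 \<le> x" "x \<le> y"
    then have "0 \<le> x * sin x" using assms by (intro mult_nonneg_nonneg sin_ge_zero) auto
    moreover have "((\<lambda>x. sin x - x * cos x) has_real_derivative x * sin x) (at x)"
      by (auto intro!: derivative_eq_intros)
    ultimately show "\<exists>l. ((\<lambda>x. sin x - x * cos x) has_real_derivative l) (at x) \<and> 0 \<le> l" by blast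
  qed (use assms in simp)
  then show ?thesis
    using assms sin_gt_zero[of y] by (simp add: cot_def field_simps)
qed

text \<open>
  The function \<open>P\<close> below is a calibration: it decreases along every admissible curve and is
  constant along the lift of the circular arc of length \<open>l\<close> that turns by \<open>2 \<phi>\<close>.
\<close>

lemma dido_inequality:
  fixes z :: "real \<Rightarrow> complex ^ ('n::finite)" and t L :: "real \<Rightarrow> real"
  assumes "a \<le> b" and contL: "continuous_on {a..b} L" and zero: "L a = 0" "z a = 0" "t a = 0"
    and dz: "\<And>u v. a \<le> u \<Longrightarrow> u \<le> v \<Longrightarrow> v \<le> b \<Longrightarrow> norm (z v - z u) \<le> L v - L u"
    and dt: "\<And>u v. a \<le> u \<Longrightarrow> u \<le> v \<Longrightarrow> v \<le> b \<Longrightarrow> t v - t u \<le> 2 * e * symp (z u) (z v) + 2 * (L v - L u)\<^sup>2"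
    and e: "e\<^sup>2 = 1" and \<phi>: "0 < \<phi>" "\<phi> < pi"
  shows "\<phi> * cot \<phi> * (norm (z b))\<^sup>2 + \<phi> * t b \<le> (L b)\<^sup>2"
proof -
  define l where "l = L b"
  have mono: "L u \<le> L v" if "a \<le> u" "u \<le> v" "v \<le> b" for u v
    using dz[OF that] norm_ge_zero[of "z v - z u"] by linarith
  have zL: "norm (z s) \<le> L s" and tL: "t s \<le> 2 * (L s)\<^sup>2" if "s \<in> {a..b}" for s
    using dz[of a s] dt[of a s] zero that by auto
  have "0 \<le> l" using mono[of a b] zero \<open>a \<le> b\<close> by (simp add: l_def)
  show ?thesis
  proof (cases "l = 0")
    case True
    then have "z b = 0" "t b \<le> 0" using zL[of b] tL[of b] \<open>a \<le> b\<close> by (auto simp: l_def)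
    then show ?thesis using \<phi> by (auto simp: mult_nonneg_nonpos intro: order_trans[of _ 0])
  next
    case False
    with \<open>0 \<le> l\<close> have "0 < l" by simp
    \<comment> \<open>Half the angle turned by the model arc after length \<open>L s\<close>; the
      chord of that arc is then \<open>l / \<phi> * sin (y s)\<close>.\<close>
    define y where "y s = \<phi> * L s / l" for s
    define P where "P s = \<phi> * cot (y s) * (norm (z s))\<^sup>2 + \<phi> * t s - l * L s" for s
    have y_b: "y b = \<phi>" using \<open>0 < l\<close> by (simp add: y_def l_def)
    have y_mono: "y u \<le> y v" if "a \<le> u" "u \<le> v" "v \<le> b" for u v
      using mono[OF that] \<phi> \<open>0 < l\<close> unfolding y_def by (intro divide_right_mono mult_left_mono) auto
    \<comment> \<open>At the start \<open>y\<close> vanishes and the cotangent is singular. Hence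
      the decrease is shown from points with \<open>0 < L s\<close> only, and \<open>small\<close>
      controls \<open>P\<close> near the start.\<close>
    have decr: "P b \<le> P s" if s: "s \<in> {a..b}" "0 < L s" for s
    proof -
      have "0 < y s" using s \<phi> \<open>0 < l\<close> by (simp add: y_def)
      moreover have "y s \<le> \<phi>" using y_mono[of s b] y_b s by simp
      ultimately obtain m where "0 < m" and "\<forall>t\<in>{y s..\<phi>}. m \<le> sin t"
        using sin_lower_bound_compact \<phi> by blast
      then have m: "m \<le> sin t" if "y s \<le> t" "t \<le> \<phi>" for t
        using that by simp
      \<comment> \<open>The terms collect the second order errors of the cotangent, of
        \<open>(norm (z v))\<^sup>2\<close> and of \<open>t\<close>, in this order.\<close>
      define K where "K = \<phi> ^ 3 / m ^ 4 + \<phi> / m + 2 * \<phi>"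
      have "P v - P u \<le> K * (L v - L u)\<^sup>2" if uv: "s \<le> u" "u \<le> v" "v \<le> b" for u v
      proof -
        define \<Delta> where "\<Delta> = L v - L u"
        define w where "w = z v - z u"
        define r where "r = norm (z u)"
        define d where "d = y v - y u"
        define S where "S = sin (y v)"
        have uv': "a \<le> u" "u \<le> b" "a \<le> v" "u \<in> {a..b}" using uv s by auto
        have d: "d = \<phi> * \<Delta> / l" by (simp add: d_def \<Delta>_def y_def diff_divide_distrib right_diff_distrib)
        have \<Delta>: "0 \<le> \<Delta>" using mono uv uv' by (simp add: \<Delta>_def)
        have w: "norm w \<le> \<Delta>" using dz uv uv' by (simp add: w_def \<Delta>_def)
        have r: "0 \<le> r" "r \<le> l" using zL[of u] mono[of u b] uv uv' by (auto simp: r_def l_def)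
        have yv: "y s \<le> y u" "y u \<le> y v" "y v \<le> \<phi>"
          using y_mono[of s u] y_mono[of u v] y_mono[of v b] uv uv' s y_b by auto
        then have S: "m \<le> S" "0 < S" using m[of "y v"] \<open>0 < m\<close> by (auto simp: S_def)
        have cot: "d / S\<^sup>2 - d\<^sup>2 / m ^ 4 \<le> cot (y u) - cot (y v)"
          unfolding d_def S_def
          by (rule cot_diff_lower_bound) (use yv \<open>0 < y s\<close> \<phi> \<open>0 < m\<close> m in auto)
        have root: "sqrt ((cot (y v))\<^sup>2 + e\<^sup>2) = 1 / S"
        proof -
          have "(cot (y v))\<^sup>2 + e\<^sup>2 = (1 / S)\<^sup>2"
            using S e sin_cos_squared_add[of "y v"] by (simp add: cot_def S_def field_simps)
          then show ?thesis using S by (simp add: real_sqrt_abs)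
        qed
        have cross: "cot (y v) * inner (z u) w + e * symp (z u) w \<le> r * \<Delta> / S"
        proof -
          have "cot (y v) * inner (z u) w + e * symp (z u) w \<le> 1 / S * norm (z u) * norm w"
            using inner_symp_bound[of "cot (y v)" "z u" w e] unfolding root by linarith
          also have "\<dots> \<le> 1 / S * norm (z u) * \<Delta>"
            using w S by (intro mult_left_mono) auto
          finally show ?thesis by (simp add: r_def)
        qed
        have quad: "cot (y v) * (norm w)\<^sup>2 \<le> \<Delta>\<^sup>2 / m"
        proof -
          have "cot (y v) \<le> 1 / S"
            unfolding cot_def S_def[symmetric] using S by (intro divide_right_mono) auto
          also have "\<dots> \<le> 1 / m" using S \<open>0 < m\<close> by (intro divide_left_mono) auto
          finally have "cot (y v) * (norm w)\<^sup>2 \<le> 1 / m * (norm w)\<^sup>2" by (intro mult_right_mono) auto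
          also have "\<dots> \<le> 1 / m * \<Delta>\<^sup>2" using w \<open>0 < m\<close> by (intro mult_left_mono power_mono) auto
          finally show ?thesis by simp
        qed
        have zv: "(norm (z v))\<^sup>2 = r\<^sup>2 + 2 * inner (z u) w + (norm w)\<^sup>2"
        proof -
          have "z v = z u + w" by (simp add: w_def)
          then show ?thesis
            unfolding r_def power2_norm_eq_inner by (simp add: inner_add_left inner_add_right inner_commute)
        qed
        have tv: "t v - t u \<le> 2 * e * symp (z u) w + 2 * \<Delta>\<^sup>2"
          using dt[of u v] uv uv' by (simp add: w_def \<Delta>_def symp_diff_right)
        have "P v - P u = \<phi> * (cot (y v) - cot (y u)) * r\<^sup>2 + 2 * \<phi> * (cot (y v) * inner (z u) w)
            + \<phi> * (cot (y v) * (norm w)\<^sup>2) + \<phi> * (t v - t u) - l * \<Delta>"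
          unfolding P_def zv by (simp add: r_def \<Delta>_def algebra_simps)
        also have "\<dots> \<le> \<phi> * (d\<^sup>2 / m ^ 4 - d / S\<^sup>2) * r\<^sup>2 + 2 * \<phi> * (cot (y v) * inner (z u) w)
            + \<phi> * (\<Delta>\<^sup>2 / m) + \<phi> * (2 * e * symp (z u) w + 2 * \<Delta>\<^sup>2) - l * \<Delta>"
        proof -
          have "\<phi> * (cot (y v) - cot (y u)) * r\<^sup>2 \<le> \<phi> * (d\<^sup>2 / m ^ 4 - d / S\<^sup>2) * r\<^sup>2"
            using cot \<phi> by (intro mult_left_mono mult_right_mono) auto
          moreover have "\<phi> * (cot (y v) * (norm w)\<^sup>2) \<le> \<phi> * (\<Delta>\<^sup>2 / m)"
            using quad \<phi> by (intro mult_left_mono) auto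
          moreover have "\<phi> * (t v - t u) \<le> \<phi> * (2 * e * symp (z u) w + 2 * \<Delta>\<^sup>2)"
            using tv \<phi> by (intro mult_left_mono) auto
          ultimately show ?thesis by linarith
        qed
        also have "\<dots> = \<phi> * (d\<^sup>2 / m ^ 4 - d / S\<^sup>2) * r\<^sup>2 + 2 * \<phi> * (cot (y v) * inner (z u) w + e * symp (z u) w)
            + \<phi> * (\<Delta>\<^sup>2 / m) + \<phi> * (2 * \<Delta>\<^sup>2) - l * \<Delta>"
          by (simp add: algebra_simps)
        also have "\<dots> \<le> \<phi> * (d\<^sup>2 / m ^ 4 - d / S\<^sup>2) * r\<^sup>2 + 2 * \<phi> * (r * \<Delta> / S)
            + \<phi> * (\<Delta>\<^sup>2 / m) + \<phi> * (2 * \<Delta>\<^sup>2) - l * \<Delta>"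
        proof -
          have "2 * \<phi> * (cot (y v) * inner (z u) w + e * symp (z u) w) \<le> 2 * \<phi> * (r * \<Delta> / S)"
            using cross \<phi> by (intro mult_left_mono) auto
          then show ?thesis by linarith
        qed
        \<comment> \<open>Since \<open>d = \<phi> * \<Delta> / l\<close>, the first order terms
          combine to a negative square. Its base vanishes exactly when \<open>r\<close> is the chord
          of the model arc.\<close>
        also have "\<dots> = - (\<Delta> / l) * (\<phi> * r / S - l)\<^sup>2 + (\<phi> ^ 3 / m ^ 4) * \<Delta>\<^sup>2 * (r / l)\<^sup>2 + (\<phi> / m + 2 * \<phi>) * \<Delta>\<^sup>2"
          unfolding d using \<open>0 < l\<close> S(2) \<open>0 < m\<close>
          by (simp add: field_simps power2_eq_square power3_eq_cube power4_eq_xxxx)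
        also have "\<dots> \<le> 0 + (\<phi> ^ 3 / m ^ 4) * \<Delta>\<^sup>2 * 1 + (\<phi> / m + 2 * \<phi>) * \<Delta>\<^sup>2"
        proof -
          have "0 \<le> (\<Delta> / l) * (\<phi> * r / S - l)\<^sup>2"
            using \<Delta> \<open>0 < l\<close> by simp
          moreover have "(\<phi> ^ 3 / m ^ 4) * \<Delta>\<^sup>2 * (r / l)\<^sup>2 \<le> (\<phi> ^ 3 / m ^ 4) * \<Delta>\<^sup>2 * 1"
          proof (intro mult_left_mono)
            show "(r / l)\<^sup>2 \<le> 1" using r \<open>0 < l\<close> by (simp add: power_le_one)
          qed (use \<phi> \<open>0 < m\<close> in simp)
          ultimately show ?thesis by linarith
        qed
        also have "\<dots> = K * \<Delta>\<^sup>2" by (simp add: K_def algebra_simps)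
        finally show ?thesis by (simp add: \<Delta>_def)
      qed
      moreover have "continuous_on {s..b} L" using contL by (rule continuous_on_subset) (use s in auto)
      ultimately show ?thesis
        using increment_square_imp_le[of s b L P K] mono s by auto
    qed
    have small: "P s \<le> 2 * \<phi> * (L s)\<^sup>2" if s: "s \<in> {a..b}" "0 < L s" for s
    proof -
      have "L s \<le> l" using mono[of s b] s by (simp add: l_def)
      then have "0 < y s" "y s \<le> \<phi>" using s \<phi> \<open>0 < l\<close> by (auto simp: y_def field_simps)
      then have "cot (y s) \<le> 1 / y s" using \<phi> by (intro cot_le_inverse) auto
      also have "\<dots> = l / (\<phi> * L s)" by (simp add: y_def)
      finally have "\<phi> * cot (y s) * (norm (z s))\<^sup>2 \<le> \<phi> * (l / (\<phi> * L s)) * (norm (z s))\<^sup>2"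
        using \<phi> by (intro mult_right_mono mult_left_mono) auto
      also have "\<dots> \<le> \<phi> * (l / (\<phi> * L s)) * (L s)\<^sup>2"
        using zL[OF s(1)] \<phi> s \<open>0 < l\<close> by (intro mult_left_mono power_mono) auto
      also have "\<dots> = l * L s" using \<phi> s by (simp add: power2_eq_square)
      finally have "\<phi> * cot (y s) * (norm (z s))\<^sup>2 \<le> l * L s" .
      moreover have "\<phi> * t s \<le> \<phi> * (2 * (L s)\<^sup>2)"
        using tL[OF s(1)] \<phi> by (intro mult_left_mono) auto
      ultimately show ?thesis by (simp add: P_def)
    qed
    have bound: "P b \<le> 2 * \<phi> * x\<^sup>2" if x: "0 < x" "x \<le> l" for x
    proof -
      obtain s where "s \<in> {a..b}" "L s = x"
        using IVT'[of L a x b] contL \<open>a \<le> b\<close> x zero by (auto simp: l_def)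
      then show ?thesis using decr[of s] small[of s] x by auto
    qed
    have "P b \<le> 0"
    proof (rule ccontr)
      assume "\<not> P b \<le> 0"
      \<comment> \<open>Chosen so that \<open>bound\<close> yields
        \<open>P b \<le> P b / 2\<close>.\<close>
      define x where "x = min l (sqrt (P b / (4 * \<phi>)))"
      have x: "0 < x" "x \<le> l" "x\<^sup>2 \<le> P b / (4 * \<phi>)"
      proof -
        show "0 < x" "x \<le> l" using \<open>\<not> P b \<le> 0\<close> \<phi> \<open>0 < l\<close> by (auto simp: x_def)
        have "x\<^sup>2 \<le> (sqrt (P b / (4 * \<phi>)))\<^sup>2" using \<open>0 < x\<close> by (intro power_mono) (auto simp: x_def)
        also have "\<dots> = P b / (4 * \<phi>)" using \<open>\<not> P b \<le> 0\<close> \<phi> by simp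
        finally show "x\<^sup>2 \<le> P b / (4 * \<phi>)" .
      qed
      have "P b \<le> 2 * \<phi> * (P b / (4 * \<phi>))"
        using bound[OF x(1,2)] x(3) \<phi> by (smt (verit) mult_left_mono zero_less_mult_iff)
      then show False using \<open>\<not> P b \<le> 0\<close> \<phi> by simp
    qed
    then show ?thesis
      by (simp add: P_def y_b l_def power2_eq_square)
  qed
qed

text \<open>The vertical coordinate of the product of the inverse of \<open>p\<close> with
  \<open>q\<close>; the horizontal one is \<open>fst q - fst p\<close>.\<close>

definition height :: "('n::finite) heis \<Rightarrow> 'n heis \<Rightarrow> real" where
  "height p q = snd q - snd p - 2 * symp (fst p) (fst q)"

lemma riem_length_lower_bound:
  fixes g :: "real \<Rightarrow> 'n::finite heis"
  assumes "a \<le> b" "horizontal_curve a b g" "riem_length a b g \<le> ennreal l" "0 \<le> l" and \<phi>: "0 < \<phi>" "\<phi> < pi"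
  shows "\<phi> * cot \<phi> * (norm (fst (g b) - fst (g a)))\<^sup>2 + \<phi> * \<bar>height (g a) (g b)\<bar> \<le> l\<^sup>2"
proof -
  obtain L where L: "continuous_on {a..b} L" "L a = 0" "L b \<le> l"
    "\<And>u v. a \<le> u \<Longrightarrow> u \<le> v \<Longrightarrow> v \<le> b \<Longrightarrow> norm (fst (g v) - fst (g u)) \<le> L v - L u"
    "\<And>u v. a \<le> u \<Longrightarrow> u \<le> v \<Longrightarrow> v \<le> b \<Longrightarrow>
       \<bar>snd (g v) - snd (g u) - 2 * symp (fst (g u)) (fst (g v))\<bar> \<le> 2 * (L v - L u)\<^sup>2"
    using horizontal_curve_increments[OF assms(1-4)] by blast
  \<comment> \<open>The sign \<open>e\<close> stands for the orientation of the enclosed area; both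
    signs together give the absolute value of the height.\<close>
  have "\<phi> * cot \<phi> * (norm (fst (g b) - fst (g a)))\<^sup>2 + \<phi> * (e * height (g a) (g b)) \<le> (L b)\<^sup>2"
    if e: "e = 1 \<or> e = -1" for e
  proof (rule dido_inequality[where a = a and b = b and e = e and L = L and
        z = "\<lambda>s. fst (g s) - fst (g a)" and t = "\<lambda>s. e * height (g a) (g s)"])
    fix u v assume uv: "a \<le> u" "u \<le> v" "v \<le> b"
    show "norm (fst (g v) - fst (g a) - (fst (g u) - fst (g a))) \<le> L v - L u"
      using L(4)[OF uv] by simp
    show "e * height (g a) (g v) - e * height (g a) (g u)
      \<le> 2 * e * symp (fst (g u) - fst (g a)) (fst (g v) - fst (g a)) + 2 * (L v - L u)\<^sup>2"
      using L(5)[OF uv] e symp_commute[of "fst (g a)" "fst (g u)"]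
      by (auto simp: height_def symp_diff_left symp_diff_right algebra_simps abs_le_iff)
  qed (use L \<phi> \<open>a \<le> b\<close> e in \<open>auto simp: height_def\<close>)
  note this[of 1] this[of "-1"]
  then have "\<phi> * cot \<phi> * (norm (fst (g b) - fst (g a)))\<^sup>2 + \<phi> * \<bar>height (g a) (g b)\<bar> \<le> (L b)\<^sup>2"
    by (auto simp: abs_if)
  also have "\<dots> \<le> l\<^sup>2"
    using L(2,3) order_trans[OF norm_ge_zero L(4)[of a b]] \<open>a \<le> b\<close> by (intro power_mono) auto
  finally show ?thesis .
qed

text \<open>The infimum is not known to be attained, so the bound is proved for every
  \<open>l > D\<close> and passed to the limit.\<close>

theorem cc_dist_lower_bound:
  fixes p q :: "'n::finite heis"
  assumes "cc_dist p q \<le> ennreal D" "0 \<le> D" and \<phi>: "0 < \<phi>" "\<phi> < pi"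
  shows "\<phi> * cot \<phi> * (norm (fst q - fst p))\<^sup>2 + \<phi> * \<bar>height p q\<bar> \<le> D\<^sup>2"
proof -
  have "\<phi> * cot \<phi> * (norm (fst q - fst p))\<^sup>2 + \<phi> * \<bar>height p q\<bar> \<le> l\<^sup>2" if "D < l" for l
  proof -
    have "cc_dist p q < ennreal l"
      using assms that by (auto intro: le_less_trans simp: ennreal_less_iff)
    then obtain a b g where "a \<le> b" "horizontal_curve a b g" "g a = p" "g b = q" "riem_length a b g < ennreal l"
      unfolding cc_dist_def Inf_less_iff by auto
    then show ?thesis
      using riem_length_lower_bound[of a b g l \<phi>] \<phi> that \<open>0 \<le> D\<close> by auto
  qed
  moreover have "((\<lambda>l. l\<^sup>2) \<longlongrightarrow> D\<^sup>2) (at_right D)"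
    by (intro tendsto_intros)
  ultimately show ?thesis
    by (intro tendsto_lowerbound[where F = "at_right D" and f = "\<lambda>l. l\<^sup>2"])
      (auto simp: eventually_at_filter)
qed

section \<open>Geodesic arcs\<close>

lemma abs_continuous_on_lipschitz:
  assumes "\<And>u v. a \<le> u \<Longrightarrow> u \<le> v \<Longrightarrow> v \<le> b \<Longrightarrow> dist (g u) (g v) \<le> M * (v - u)"
  shows "abs_continuous_on a b g"
  unfolding abs_continuous_on_def
proof (intro allI impI)
  fix e :: real assume "0 < e"
  define K where "K = \<bar>M\<bar> + 1"
  have "0 < K" "M \<le> K" by (auto simp: K_def)
  show "\<exists>\<delta>>0. \<forall>(m::nat) u v. (\<forall>i<m. a \<le> u i \<and> u i \<le> v i \<and> v i \<le> b) \<and>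
        disjoint_family_on (\<lambda>i. {u i<..<v i}) {..<m} \<and> (\<Sum>i<m. v i - u i) < \<delta>
        \<longrightarrow> (\<Sum>i<m. dist (g (u i)) (g (v i))) < e"
  proof (intro exI[of _ "e / K"] conjI allI impI)
    fix m :: nat and u v
    assume *: "(\<forall>i<m. a \<le> u i \<and> u i \<le> v i \<and> v i \<le> b) \<and>
        disjoint_family_on (\<lambda>i. {u i<..<v i}) {..<m} \<and> (\<Sum>i<m. v i - u i) < e / K"
    have "(\<Sum>i<m. dist (g (u i)) (g (v i))) \<le> (\<Sum>i<m. K * (v i - u i))"
    proof (rule sum_mono)
      fix i assume "i \<in> {..<m}"
      then have i: "a \<le> u i" "u i \<le> v i" "v i \<le> b" using * by auto
      have "M * (v i - u i) \<le> K * (v i - u i)" using i \<open>M \<le> K\<close> by (intro mult_right_mono) auto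
      then show "dist (g (u i)) (g (v i)) \<le> K * (v i - u i)" using assms[OF i] by linarith
    qed
    also have "\<dots> < e"
      using * \<open>0 < K\<close> by (simp add: sum_distrib_left[symmetric] pos_less_divide_eq mult.commute)
    finally show "(\<Sum>i<m. dist (g (u i)) (g (v i))) < e" .
  qed (use \<open>0 < e\<close> \<open>0 < K\<close> in auto)
qed

lemma cc_dist_le_smooth_curve:
  fixes Z Z' :: "real \<Rightarrow> complex ^ ('n::finite)" and T :: "real \<Rightarrow> real"
  assumes Z: "\<And>s. (Z has_vector_derivative Z' s) (at s)"
    and T: "\<And>s. (T has_real_derivative 2 * symp (Z s) (Z' s)) (at s)"
    and speed: "\<And>s. norm (Z' s) = c"
  shows "cc_dist (Z 0, T 0) (Z 1, T 1) \<le> ennreal c"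
proof -
  define g where "g s = (Z s, T s)" for s
  define g' where "g' s = (Z' s, 2 * symp (Z s) (Z' s))" for s
  have g: "(g has_vector_derivative g' s) (at s)" for s
    unfolding g_def g'_def
    using Z[of s] T[of s] by (intro has_vector_derivative_Pair) (auto simp: has_real_derivative_iff_has_vector_derivative)
  then have vd: "vector_derivative g (at s) = g' s" for s
    by (rule vector_derivative_at)
  have vert: "heis_vert (g s) (g' s) = 0" for s
    by (simp add: heis_vert_symp g_def g'_def)
  have "0 \<le> c" using speed[of 0] norm_ge_zero by metis
  have "continuous_on {0..1} Z"
    using Z by (meson continuous_at_imp_continuous_on has_vector_derivative_continuous)
  then obtain B where B: "\<And>s. s \<in> {0..1} \<Longrightarrow> norm (Z s) \<le> B"
    using compact_continuous_image[of "{0..1::real}" Z] compact_Icc[of 0 "1::real"]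
    by (metis bounded_iff compact_imp_bounded image_eqI)
  have "abs_continuous_on 0 1 g"
  proof (rule abs_continuous_on_lipschitz)
    fix u v :: real assume uv: "0 \<le> u" "u \<le> v" "v \<le> 1"
    have "norm (g v - g u) \<le> (c + 2 * (B * c)) * norm (v - u)"
    proof (rule differentiable_bound[of "{0..1}"])
      fix s :: real assume s: "s \<in> {0..1}"
      show "(g has_derivative (\<lambda>h. h *\<^sub>R g' s)) (at s within {0..1})"
        using g[of s] unfolding has_vector_derivative_def by (rule has_derivative_at_withinI)
      have "norm (g' s) \<le> norm (Z' s) + norm (2 * symp (Z s) (Z' s))"
        unfolding g'_def by (rule norm_Pair_le)
      also have "\<dots> \<le> c + 2 * (B * c)"
      proof -
        have "\<bar>symp (Z s) (Z' s)\<bar> \<le> norm (Z s) * c"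
          using abs_symp_le[of "Z s" "Z' s"] by (simp add: speed)
        also have "\<dots> \<le> B * c" using B[OF s] \<open>0 \<le> c\<close> by (intro mult_right_mono)
        finally show ?thesis by (simp add: speed)
      qed
      finally have "norm (g' s) \<le> c + 2 * (B * c)" .
      then show "onorm (\<lambda>h. h *\<^sub>R g' s) \<le> c + 2 * (B * c)"
        by (intro onorm_le) (metis mult.commute norm_scaleR real_norm_def abs_ge_zero mult_left_mono)
    qed (use uv in auto)
    then show "dist (g u) (g v) \<le> (c + 2 * (B * c)) * (v - u)"
      using uv by (simp add: dist_norm norm_minus_commute)
  qed
  moreover have "g differentiable (at s)" for s
    using g by (rule differentiableI_vector)
  ultimately have "horizontal_curve 0 1 g"
    unfolding horizontal_curve_def horizontal_iff_heis_vert vd vert by simp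
  moreover have "riem_length 0 1 g = ennreal c"
  proof -
    have "riem_length 0 1 g = (\<integral>\<^sup>+s. ennreal c * indicator {0..1::real} s \<partial>lebesgue)"
      unfolding riem_length_def vd heis_metric_self vert
      using \<open>0 \<le> c\<close> by (simp add: g'_def speed)
    then show ?thesis by (simp add: nn_integral_cmult_indicator)
  qed
  ultimately have "ennreal c = riem_length 0 1 g \<and> (0::real) \<le> 1 \<and> horizontal_curve 0 1 g \<and>
      g 0 = (Z 0, T 0) \<and> g 1 = (Z 1, T 1)"
    by (simp add: g_def)
  then have "ennreal c \<in> {riem_length a b g |a b g. a \<le> b \<and> horizontal_curve a b g \<and>
      g a = (Z 0, T 0) \<and> g b = (Z 1, T 1)}"
    by blast
  then show ?thesis unfolding cc_dist_def by (rule Inf_lower)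
qed

text \<open>A lift starting at the origin is moved to \<open>p\<close> by left translation, so only
  the left-invariant coordinates of the end point enter.\<close>

lemma cc_dist_le_translated_curve:
  fixes Z Z' :: "real \<Rightarrow> complex ^ ('n::finite)" and T :: "real \<Rightarrow> real"
  assumes Z: "\<And>s. (Z has_vector_derivative Z' s) (at s)"
    and T: "\<And>s. (T has_real_derivative 2 * symp (Z s) (Z' s)) (at s)"
    and speed: "\<And>s. norm (Z' s) = c"
    and "Z 0 = 0" "T 0 = 0" "Z 1 = fst q - fst p" "T 1 = height p q"
  shows "cc_dist p q \<le> ennreal c"
proof -
  have "cc_dist (fst p + Z 0, snd p + T 0 + 2 * symp (fst p) (Z 0))
     (fst p + Z 1, snd p + T 1 + 2 * symp (fst p) (Z 1)) \<le> ennreal c"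
  proof (rule cc_dist_le_smooth_curve)
    fix s
    show "((\<lambda>s. fst p + Z s) has_vector_derivative Z' s) (at s)"
      using Z[of s] by (auto intro!: derivative_eq_intros)
    have "((\<lambda>s. symp (fst p) (Z s)) has_real_derivative symp (fst p) (Z' s)) (at s)"
      unfolding has_real_derivative_iff_has_vector_derivative
      by (rule bounded_linear.has_vector_derivative[OF
            bounded_bilinear.bounded_linear_right[OF bounded_bilinear_symp] Z])
    then show "((\<lambda>s. snd p + T s + 2 * symp (fst p) (Z s)) has_real_derivative
       2 * symp (fst p + Z s) (Z' s)) (at s)"
      using T[of s] by (auto intro!: derivative_eq_intros simp: symp_add_left)
    show "norm (Z' s) = c" by (rule speed)
  qed
  then show ?thesis
    by (simp add: assms(4-) height_def symp_diff_right)
qed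

lemma cc_dist_le_line:
  assumes "height p q = 0"
  shows "cc_dist p q \<le> ennreal (norm (fst q - fst p))"
proof (rule cc_dist_le_translated_curve)
  fix s :: real
  show "((\<lambda>s. s *\<^sub>R (fst q - fst p)) has_vector_derivative (fst q - fst p)) (at s)"
    by (auto intro!: derivative_eq_intros)
  show "((\<lambda>s. 0) has_real_derivative 2 * symp (s *\<^sub>R (fst q - fst p)) (fst q - fst p)) (at s)"
    by simp
qed (use assms in auto)

lemma symp_complex_scale2:
  "symp (a *s z) (b *s z) = Im (a * cnj b) * (norm z)\<^sup>2" for z :: "complex ^ ('n::finite)"
proof -
  have "symp (a *s z) (b *s z) = (\<Sum>j\<in>UNIV. Im (a * cnj b) * (cmod (z $ j))\<^sup>2)"
    unfolding symp_def
  proof (rule sum.cong)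
    fix j
    have "(a *s z) $ j * cnj ((b *s z) $ j) = a * cnj b * of_real ((cmod (z $ j))\<^sup>2)"
      by (simp add: complex_norm_square mult_ac del: of_real_power)
    moreover have "Im (c * of_real r) = Im c * r" for c r by simp
    ultimately show "Im ((a *s z) $ j * cnj ((b *s z) $ j)) = Im (a * cnj b) * (cmod (z $ j))\<^sup>2"
      by (simp only:)
  qed simp
  also have "\<dots> = Im (a * cnj b) * (norm z)\<^sup>2"
    by (simp add: sum_distrib_left[symmetric] power2_norm_eq_inner[of z] inner_vec_def power2_norm_eq_inner)
  finally show ?thesis .
qed

text \<open>Lifts of circular arcs through the origin, turning by the angle \<open>x\<close>.\<close>

lemma cc_dist_le_arc:
  fixes v :: "complex ^ ('n::finite)"
  assumes w: "fst q - fst p = (cis x - 1) *s v" and h: "height p q = - 2 * (norm v)\<^sup>2 * (x - sin x)"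
  shows "cc_dist p q \<le> ennreal (\<bar>x\<bar> * norm v)"
proof (rule cc_dist_le_translated_curve)
  fix s :: real
  have lin: "bounded_linear (\<lambda>c. c *s v)"
    by (intro linear_conv_bounded_linear[THEN iffD1] linearI)
      (simp_all add: vector_sadd_rdistrib vec_eq_iff)
  have "((\<lambda>s. exp (s *\<^sub>R (\<i> * of_real x)) - 1) has_vector_derivative exp (s *\<^sub>R (\<i> * of_real x)) * (\<i> * of_real x)) (at s)"
    by (auto intro!: derivative_eq_intros exp_scaleR_has_vector_derivative_right)
  moreover have "exp (s *\<^sub>R (\<i> * of_real x)) = cis (s * x)" for s
    by (simp add: cis_conv_exp scaleR_conv_of_real mult_ac)
  ultimately have "((\<lambda>s. cis (s * x) - 1) has_vector_derivative cis (s * x) * (\<i> * of_real x)) (at s)"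
    by simp
  then show "((\<lambda>s. (cis (s * x) - 1) *s v) has_vector_derivative (cis (s * x) * (\<i> * of_real x)) *s v) (at s)"
    by (rule bounded_linear.has_vector_derivative[OF lin])
  have "symp ((cis (s * x) - 1) *s v) ((cis (s * x) * (\<i> * of_real x)) *s v) =
     - x * (1 - cos (s * x)) * (norm v)\<^sup>2"
  proof -
    have "Im ((cis (s * x) - 1) * cnj (cis (s * x) * (\<i> * of_real x))) = - x * (1 - cos (s * x))"
      using sin_cos_squared_add[of "s * x"] by (simp add: power2_eq_square algebra_simps flip: distrib_left)
    then show ?thesis by (simp only: symp_complex_scale2)
  qed
  then show "((\<lambda>s. - 2 * (norm v)\<^sup>2 * (s * x - sin (s * x))) has_real_derivative
     2 * symp ((cis (s * x) - 1) *s v) ((cis (s * x) * (\<i> * of_real x)) *s v)) (at s)"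
    by (auto intro!: derivative_eq_intros simp: algebra_simps)
  show "norm ((cis (s * x) * (\<i> * of_real x)) *s v) = \<bar>x\<bar> * norm v"
    by (simp add: norm_complex_scale norm_mult)
qed (use w h in auto)

lemma cos_le_mult_cot:
  assumes "0 < x" "x \<le> pi / 2" shows "cos x \<le> x * cot x"
proof -
  have "0 < sin x" "sin x \<le> x" "0 \<le> cos x"
    using assms sin_gt_zero[of x] cos_ge_zero[of x] by (auto intro: sin_x_le_x)
  then have "sin x * cos x \<le> x * cos x" by (intro mult_right_mono)
  then show ?thesis using \<open>0 < sin x\<close> by (simp add: cot_def field_simps)
qed

text \<open>The limit \<open>\<phi> \<longrightarrow> 0\<close>, where
  \<open>\<phi> * cot \<phi>\<close> tends to 1; the continuous minorant \<open>cos \<phi>\<close>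
  has the same limit.\<close>

lemma le_of_mult_cot_bound:
  fixes x D :: real
  assumes "0 \<le> x" "0 \<le> D" and bound: "\<And>\<phi>. 0 < \<phi> \<Longrightarrow> \<phi> < pi / 2 \<Longrightarrow> \<phi> * cot \<phi> * x\<^sup>2 \<le> D\<^sup>2"
  shows "x \<le> D"
proof -
  have "cos \<phi> * x\<^sup>2 \<le> D\<^sup>2" if "0 < \<phi>" "\<phi> < pi / 2" for \<phi>
  proof -
    have "cos \<phi> * x\<^sup>2 \<le> \<phi> * cot \<phi> * x\<^sup>2"
      using that cos_le_mult_cot by (intro mult_right_mono) auto
    also have "\<dots> \<le> D\<^sup>2" using bound[OF that] .
    finally show ?thesis .
  qed
  then have "\<forall>\<^sub>F \<phi> in at_right 0. cos \<phi> * x\<^sup>2 \<le> D\<^sup>2"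
    unfolding eventually_at_right[OF pi_half_gt_zero] by (intro exI[of _ "pi / 2"]) auto
  moreover have "((\<lambda>\<phi>. cos \<phi> * x\<^sup>2) \<longlongrightarrow> cos 0 * x\<^sup>2) (at_right 0)"
    by (intro tendsto_intros)
  ultimately have "cos 0 * x\<^sup>2 \<le> D\<^sup>2" by (intro tendsto_upperbound) auto
  then have "x\<^sup>2 \<le> D\<^sup>2" by simp
  then show ?thesis using \<open>0 \<le> D\<close> by (rule power2_le_imp_le)
qed

text \<open>The equation characterises half the turning angle of an arc with squared chord
  \<open>A\<close> and height \<open>\<tau>\<close>. Clearing denominators extends it to
  \<open>pi\<close>, but both sides vanish at 0, so the intermediate value theorem needs a positive
  left end.\<close>

lemma arc_angle_exists:
  assumes "0 < \<tau>" "0 < A"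
  obtains \<phi> :: real where "0 < \<phi>" "\<phi> < pi" "\<tau> * (sin \<phi>)\<^sup>2 = A * (\<phi> - sin \<phi> * cos \<phi>)"
proof -
  define f where "f \<phi> = \<tau> * (sin \<phi>)\<^sup>2 - A * (\<phi> - sin \<phi> * cos \<phi>)" for \<phi>
  \<comment> \<open>The second bound gives \<open>2 * y * A < \<tau>\<close>; the first keeps the
    sine increasing up to \<open>y\<close>.\<close>
  define y where "y = min (pi / 2) (\<tau> / (4 * A))"
  have y: "0 < y" "y \<le> pi / 2" using assms by (auto simp: y_def)
  have "2 * y * A < \<tau>"
  proof -
    have "y * (4 * A) \<le> \<tau>" using assms by (simp add: y_def min_def field_simps)
    then show ?thesis using assms by linarith
  qed
  obtain t where t: "0 < t" "t < y" "(y - sin y * cos y) - (0 - sin 0 * cos 0) = (y - 0) * (2 * (sin t)\<^sup>2)"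
  proof -
    have "((\<lambda>x. x - sin x * cos x) has_real_derivative 2 * (sin x)\<^sup>2) (at x)" for x
      by (auto intro!: derivative_eq_intros simp: power2_eq_square[symmetric] cos_squared_eq)
    then show thesis
      using MVT2[OF y(1), of "\<lambda>x. x - sin x * cos x" "\<lambda>x. 2 * (sin x)\<^sup>2"] that by auto
  qed
  have "0 < sin t" "sin t \<le> sin y"
    using t y by (auto intro: sin_gt_zero sin_monotone_2pi_le)
  then have "y - sin y * cos y \<le> 2 * y * (sin y)\<^sup>2"
    using t y by (simp add: mult_left_mono power_mono)
  then have "A * (y - sin y * cos y) \<le> A * (2 * y * (sin y)\<^sup>2)"
    using assms by (intro mult_left_mono) auto
  also have "\<dots> < \<tau> * (sin y)\<^sup>2"
    using \<open>2 * y * A < \<tau>\<close> \<open>0 < sin t\<close> \<open>sin t \<le> sin y\<close> by (simp add: mult_ac)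
  finally have "0 < f y" by (simp add: f_def)
  moreover have "f pi < 0" using assms by (simp add: f_def)
  moreover have "continuous_on {y..pi} f" unfolding f_def by (intro continuous_intros)
  ultimately obtain \<phi> where "y \<le> \<phi>" "\<phi> \<le> pi" "f \<phi> = 0"
    using IVT2'[of f pi 0 y] y by (auto simp: less_imp_le)
  moreover from this have "\<phi> \<noteq> pi" using \<open>f pi < 0\<close> by auto
  ultimately show thesis using that[of \<phi>] y by (auto simp: f_def)
qed

text \<open>Each case needs the hypothesis only at the angle of its own geodesic: near 0 for a
  segment, near \<open>pi\<close> for a full circle, and at the angle from
  \<open>arc_angle_exists\<close> otherwise.\<close>

theorem cc_dist_upper_bound:
  fixes p q :: "('n::finite) heis"
  assumes "0 \<le> D" and bound: "\<And>\<phi>. 0 < \<phi> \<Longrightarrow> \<phi> < pi \<Longrightarrow>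
      \<phi> * cot \<phi> * (norm (fst q - fst p))\<^sup>2 + \<phi> * \<bar>height p q\<bar> \<le> D\<^sup>2"
  shows "cc_dist p q \<le> ennreal D"
proof -
  define w where "w = fst q - fst p"
  define \<tau> where "\<tau> = height p q"
  define \<epsilon> :: real where "\<epsilon> = (if \<tau> < 0 then -1 else 1)"
  have \<epsilon>: "\<epsilon> * \<bar>\<tau>\<bar> = \<tau>" "\<bar>\<tau>\<bar> * \<epsilon> = \<tau>" "\<epsilon> * \<epsilon> = 1" "\<bar>\<epsilon>\<bar> = 1" by (auto simp: \<epsilon>_def)
  consider "\<tau> = 0" | "\<tau> \<noteq> 0" "w = 0" | "\<tau> \<noteq> 0" "w \<noteq> 0" by blast
  then show ?thesis
  proof cases
    case 1
    have "norm w \<le> D"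
    proof (rule le_of_mult_cot_bound)
      fix \<phi> :: real assume "0 < \<phi>" "\<phi> < pi / 2"
      then show "\<phi> * cot \<phi> * (norm w)\<^sup>2 \<le> D\<^sup>2" using bound[of \<phi>] 1 by (simp add: w_def \<tau>_def)
    qed (use \<open>0 \<le> D\<close> in auto)
    then show ?thesis
      using cc_dist_le_line[of p q] 1 by (metis \<tau>_def w_def ennreal_leI order_trans)
  next
    case 2
    have "\<forall>\<^sub>F \<phi> in at_left pi. \<phi> * \<bar>\<tau>\<bar> \<le> D\<^sup>2"
      using bound 2 by (auto simp: eventually_at_left[of 0 pi] w_def \<tau>_def intro: exI[of _ 0])
    moreover have "((\<lambda>\<phi>. \<phi> * \<bar>\<tau>\<bar>) \<longlongrightarrow> pi * \<bar>\<tau>\<bar>) (at_left pi)"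
      by (intro tendsto_intros)
    ultimately have D: "pi * \<bar>\<tau>\<bar> \<le> D\<^sup>2" by (intro tendsto_upperbound) auto
    \<comment> \<open>Any direction works, so an arbitrary coordinate is taken. A full circle of
      radius \<open>norm v\<close> lifts to height \<open>4 * pi * (norm v)\<^sup>2\<close>, which
      is to equal \<open>\<bar>\<tau>\<bar>\<close>.\<close>
    define v :: "complex ^ 'n" where "v = sqrt (\<bar>\<tau>\<bar> / (4 * pi)) *\<^sub>R axis undefined 1"
    have v: "norm v = sqrt (\<bar>\<tau>\<bar> / (4 * pi))" by (simp add: v_def)
    have "cc_dist p q \<le> ennreal (\<bar>- 2 * \<epsilon> * pi\<bar> * norm v)"
    proof (rule cc_dist_le_arc)
      have "cis (- 2 * \<epsilon> * pi) = 1" by (auto simp: \<epsilon>_def complex_eq_iff)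
      then show "fst q - fst p = (cis (- 2 * \<epsilon> * pi) - 1) *s v" using 2 by (simp add: w_def)
      have "sin (- 2 * \<epsilon> * pi) = 0" by (auto simp: \<epsilon>_def)
      then show "height p q = - 2 * (norm v)\<^sup>2 * (- 2 * \<epsilon> * pi - sin (- 2 * \<epsilon> * pi))"
        using \<epsilon> by (simp add: v flip: \<tau>_def)
    qed
    also have "\<bar>- 2 * \<epsilon> * pi\<bar> * norm v \<le> D"
    proof (rule power2_le_imp_le)
      have "(\<bar>- 2 * \<epsilon> * pi\<bar> * norm v)\<^sup>2 = pi * \<bar>\<tau>\<bar>"
        using \<epsilon> by (simp add: v power_mult_distrib power2_eq_square abs_mult field_simps)
      then show "(\<bar>- 2 * \<epsilon> * pi\<bar> * norm v)\<^sup>2 \<le> D\<^sup>2" using D by simp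
    qed fact
    finally show ?thesis by (simp add: ennreal_leI)
  next
    case 3
    then obtain \<phi> where \<phi>: "0 < \<phi>" "\<phi> < pi" and eq: "\<bar>\<tau>\<bar> * (sin \<phi>)\<^sup>2 = (norm w)\<^sup>2 * (\<phi> - sin \<phi> * cos \<phi>)"
      using arc_angle_exists[of "\<bar>\<tau>\<bar>" "(norm w)\<^sup>2"] by auto
    have s: "0 < sin \<phi>" using \<phi> by (rule sin_gt_zero)
    \<comment> \<open>The sign is reversed because an arc turning by a positive angle loses
      height.\<close>
    define x where "x = - 2 * \<epsilon> * \<phi>"
    define k where "k = cis x - 1"
    define v where "v = (1 / k) *s w"
    have "(cmod k)\<^sup>2 = 2 - 2 * cos x"
      using sin_cos_squared_add[of x] unfolding k_def cmod_power2 by (simp add: power2_eq_square algebra_simps)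
    also have "cos x = cos (2 * \<phi>)" by (auto simp: x_def \<epsilon>_def)
    finally have k2: "(cmod k)\<^sup>2 = (2 * sin \<phi>)\<^sup>2"
      by (simp only: cos_double_sin) (simp add: power_mult_distrib)
    have k: "cmod k = 2 * sin \<phi>" by (rule power2_eq_imp_eq[OF k2]) (use s in simp_all)
    then have "k \<noteq> 0" using s by auto
    have v: "norm v = norm w / (2 * sin \<phi>)" by (simp add: v_def norm_complex_scale norm_divide k)
    have "cc_dist p q \<le> ennreal (\<bar>x\<bar> * norm v)"
    proof (rule cc_dist_le_arc)
      show "fst q - fst p = (cis x - 1) *s v"
        using \<open>k \<noteq> 0\<close> by (simp add: v_def vector_smult_assoc w_def flip: k_def)
      have "x - sin x = - 2 * \<epsilon> * (\<phi> - sin \<phi> * cos \<phi>)"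
        by (auto simp: x_def \<epsilon>_def sin_double)
      then have "- 2 * (norm v)\<^sup>2 * (x - sin x) = \<epsilon> * ((norm w)\<^sup>2 * (\<phi> - sin \<phi> * cos \<phi>)) / (sin \<phi>)\<^sup>2"
        using s by (simp add: v power_divide power_mult_distrib)
      also have "\<dots> = \<epsilon> * \<bar>\<tau>\<bar>" using s by (simp flip: eq)
      finally show "height p q = - 2 * (norm v)\<^sup>2 * (x - sin x)" using \<epsilon> by (simp add: \<tau>_def)
    qed
    also have "\<bar>x\<bar> * norm v \<le> D"
    proof (rule power2_le_imp_le)
      have tau: "\<bar>\<tau>\<bar> = (norm w)\<^sup>2 * (\<phi> - sin \<phi> * cos \<phi>) / (sin \<phi>)\<^sup>2"
        using eq s by (simp add: field_simps)
      \<comment> \<open>The calibration is an equality for the arc at its own angle.\<close>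
      have "\<phi> * cot \<phi> * (norm w)\<^sup>2 + \<phi> * \<bar>\<tau>\<bar> = (\<bar>x\<bar> * norm v)\<^sup>2"
        using s \<epsilon>(4) \<phi> unfolding tau by (simp add: cot_def v x_def abs_mult power_mult_distrib power_divide power2_eq_square field_simps)
      then show "(\<bar>x\<bar> * norm v)\<^sup>2 \<le> D\<^sup>2" using bound[OF \<phi>] by (simp add: w_def \<tau>_def)
    qed fact
    finally show ?thesis by (simp add: ennreal_leI)
  qed
qed

text \<open>The angle \<open>\<phi>\<close> belongs to the calibration by the arc turning by \<open>2 \<phi>\<close>; full circles give \<open>\<phi> = pi\<close>.\<close>

theorem cc_dist_le_iff:
  fixes p q :: "('n::finite) heis"
  assumes "0 \<le> D"
  shows "cc_dist p q \<le> ennreal D \<longleftrightarrow> (\<forall>\<phi>. 0 < \<phi> \<and> \<phi> < pi \<longrightarrow>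
      \<phi> * cot \<phi> * (norm (fst q - fst p))\<^sup>2 + \<phi> * \<bar>height p q\<bar> \<le> D\<^sup>2)"
  using cc_dist_lower_bound[OF _ assms] cc_dist_upper_bound[OF assms] by blast

section \<open>Volume and diameter\<close>

lemma emeasure_lborel_slices:
  fixes E :: "('a::euclidean_space \<times> 'b::euclidean_space) set"
  assumes "E \<in> sets borel"
  shows "emeasure lborel E = (\<integral>\<^sup>+z. emeasure lborel (Pair z -` E) \<partial>lborel)"
    and "(\<lambda>z. emeasure lborel (Pair z -` E)) \<in> borel_measurable borel"
proof -
  have E: "E \<in> sets (lborel \<Otimes>\<^sub>M lborel)" unfolding lborel_prod using assms by simp
  show "emeasure lborel E = (\<integral>\<^sup>+z. emeasure lborel (Pair z -` E) \<partial>lborel)"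
    using lborel.emeasure_pair_measure_alt[OF E] by (simp add: lborel_prod)
  show "(\<lambda>z. emeasure lborel (Pair z -` E)) \<in> borel_measurable borel"
    using lborel.measurable_emeasure_Pair[OF E] by simp
qed

lemma nn_integral_lborel_affine:
  fixes f :: "'a::euclidean_space \<Rightarrow> ennreal"
  assumes [measurable]: "f \<in> borel_measurable borel" and "s \<noteq> 0"
  shows "(\<integral>\<^sup>+z. f z \<partial>lborel) = ennreal (\<bar>s\<bar> ^ DIM('a)) * (\<integral>\<^sup>+z. f (b + s *\<^sub>R z) \<partial>lborel)"
  by (subst lborel_affine[OF \<open>s \<noteq> 0\<close>, of b])
     (simp add: nn_integral_density nn_integral_distr nn_integral_cmult)

lemma closed_slice: "closed E \<Longrightarrow> closed (Pair z -` E)"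
  by (intro closed_vimage continuous_intros)

text \<open>Covers left translations, dilations and vertical shears in one computation.\<close>

lemma emeasure_affine_shear:
  fixes E :: "('a::euclidean_space \<times> real) set" and b :: 'a and c :: "'a \<Rightarrow> real" and r s :: real
  assumes "compact E" "0 < s" "0 < r" "continuous_on UNIV c"
  defines "T \<equiv> \<lambda>p. (b + s *\<^sub>R fst p, c (fst p) + r * snd p)"
  shows "compact (T ` E)" and "emeasure lborel (T ` E) = ennreal (s ^ DIM('a) * r) * emeasure lborel E"
proof -
  have "continuous_on E T"
    unfolding T_def
    by (intro continuous_intros continuous_on_compose2[OF assms(4)]) auto
  then show TE: "compact (T ` E)" using \<open>compact E\<close> by (rule compact_continuous_image)
  have slice: "emeasure lborel (Pair (b + s *\<^sub>R z) -` (T ` E)) = ennreal r * emeasure lborel (Pair z -` E)" for z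
  proof -
    have "Pair (b + s *\<^sub>R z) -` (T ` E) = (\<lambda>t. r *\<^sub>R t + c z) ` (Pair z -` E)"
    proof (intro set_eqI iffI)
      fix t assume "t \<in> Pair (b + s *\<^sub>R z) -` (T ` E)"
      then obtain p where p: "p \<in> E" "(b + s *\<^sub>R z, t) = T p" by auto
      then have "fst p = z" "t = c z + r * snd p" using \<open>0 < s\<close> by (auto simp: T_def)
      then show "t \<in> (\<lambda>t. r *\<^sub>R t + c z) ` (Pair z -` E)"
        using p(1) by (intro image_eqI[of _ _ "snd p"]) auto
    next
      fix t assume "t \<in> (\<lambda>t. r *\<^sub>R t + c z) ` (Pair z -` E)"
      then obtain u where "(z, u) \<in> E" "t = r * u + c z" by auto
      then show "t \<in> Pair (b + s *\<^sub>R z) -` (T ` E)"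
        by (auto simp: T_def intro!: image_eqI[of _ _ "(z, u)"])
    qed
    then have "emeasure lebesgue (Pair (b + s *\<^sub>R z) -` (T ` E)) = ennreal r * emeasure lebesgue (Pair z -` E)"
      using \<open>0 < r\<close> emeasure_lebesgue_affine[of r "c z" "Pair z -` E"] by simp
    then show ?thesis
      using closed_slice[of E z] closed_slice[of "T ` E" "b + s *\<^sub>R z"] TE \<open>compact E\<close>
      by (simp add: compact_imp_closed)
  qed
  have borel: "E \<in> sets borel" "T ` E \<in> sets borel"
    using TE \<open>compact E\<close> by (auto simp: compact_imp_closed)
  have "emeasure lborel (T ` E) = (\<integral>\<^sup>+z. emeasure lborel (Pair z -` (T ` E)) \<partial>lborel)"
    by (rule emeasure_lborel_slices(1)[OF borel(2)])
  also have "\<dots> = ennreal (\<bar>s\<bar> ^ DIM('a)) * (\<integral>\<^sup>+z. emeasure lborel (Pair (b + s *\<^sub>R z) -` (T ` E)) \<partial>lborel)"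
    using \<open>0 < s\<close> by (intro nn_integral_lborel_affine emeasure_lborel_slices(2)[OF borel(2)]) auto
  also have "\<dots> = ennreal (s ^ DIM('a)) * (ennreal r * (\<integral>\<^sup>+z. emeasure lborel (Pair z -` E) \<partial>lborel))"
    unfolding slice using \<open>0 < s\<close> emeasure_lborel_slices(2)[OF borel(1)] by (simp add: nn_integral_cmult)
  also have "\<dots> = ennreal (s ^ DIM('a) * r) * emeasure lborel E"
    unfolding emeasure_lborel_slices(1)[OF borel(1), symmetric]
    using \<open>0 < s\<close> \<open>0 < r\<close> by (simp add: ennreal_mult mult.assoc)
  finally show "emeasure lborel (T ` E) = ennreal (s ^ DIM('a) * r) * emeasure lborel E" .
qed

section \<open>Translations, dilations and crude bounds for distance and diameter\<close>

definition heis_dil :: "real \<Rightarrow> ('n::finite) heis \<Rightarrow> 'n heis" where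
  "heis_dil s p = (s *\<^sub>R fst p, s\<^sup>2 * snd p)"

lemma height_heis_mult: "height (heis_mult a p) (heis_mult a q) = height p q"
  using symp_commute[of "fst a" "fst p"]
  by (simp add: height_def heis_mult_symp symp_add_left symp_add_right symp_commute[of "fst p" "fst a"])

lemma fst_heis_mult [simp]: "fst (heis_mult a p) = fst a + fst p"
  by (simp add: heis_mult_symp)

lemma cc_dist_heis_mult_le:
  "0 \<le> D \<Longrightarrow> cc_dist (heis_mult a p) (heis_mult a q) \<le> ennreal D \<longleftrightarrow> cc_dist p q \<le> ennreal D"
  by (simp add: cc_dist_le_iff height_heis_mult)

lemma cc_dist_heis_dil_le:
  assumes "0 \<le> D" "0 < s" "cc_dist p q \<le> ennreal D"
  shows "cc_dist (heis_dil s p) (heis_dil s q) \<le> ennreal (s * D)"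
proof -
  have h: "\<bar>height (heis_dil s p) (heis_dil s q)\<bar> = s\<^sup>2 * \<bar>height p q\<bar>"
  proof -
    have "height (heis_dil s p) (heis_dil s q) = s\<^sup>2 * height p q"
      by (simp add: height_def heis_dil_def algebra_simps power2_eq_square)
    then show ?thesis by (simp add: abs_mult)
  qed
  have w: "(norm (fst (heis_dil s q) - fst (heis_dil s p)))\<^sup>2 = s\<^sup>2 * (norm (fst q - fst p))\<^sup>2"
    by (simp add: heis_dil_def scaleR_diff_right[symmetric] power_mult_distrib)
  have "\<phi> * cot \<phi> * (s\<^sup>2 * (norm (fst q - fst p))\<^sup>2) + \<phi> * (s\<^sup>2 * \<bar>height p q\<bar>) \<le> (s * D)\<^sup>2"
    if "0 < \<phi>" "\<phi> < pi" for \<phi>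
  proof -
    have "\<phi> * cot \<phi> * (norm (fst q - fst p))\<^sup>2 + \<phi> * \<bar>height p q\<bar> \<le> D\<^sup>2"
      using assms that by (simp add: cc_dist_le_iff)
    then have "s\<^sup>2 * (\<phi> * cot \<phi> * (norm (fst q - fst p))\<^sup>2 + \<phi> * \<bar>height p q\<bar>) \<le> s\<^sup>2 * D\<^sup>2"
      by (intro mult_left_mono) auto
    then show ?thesis by (simp add: algebra_simps power_mult_distrib)
  qed
  then show ?thesis
    using assms by (simp add: cc_dist_le_iff h w)
qed

lemma cc_diam_le_iff: "cc_diam F \<le> x \<longleftrightarrow> (\<forall>p\<in>F. \<forall>q\<in>F. cc_dist p q \<le> x)"
  by (simp add: cc_diam_def SUP_le_iff)

lemma norm_le_of_cc_dist:
  assumes "0 \<le> D" "cc_dist p q \<le> ennreal D"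
  shows "norm (fst q - fst p) \<le> D"
proof (rule le_of_mult_cot_bound)
  fix \<phi> :: real assume \<phi>: "0 < \<phi>" "\<phi> < pi / 2"
  have "\<phi> * cot \<phi> * (norm (fst q - fst p))\<^sup>2 \<le> \<phi> * cot \<phi> * (norm (fst q - fst p))\<^sup>2 + \<phi> * \<bar>height p q\<bar>"
    using \<phi> by simp
  also have "\<dots> \<le> D\<^sup>2" using assms \<phi> by (simp add: cc_dist_le_iff)
  finally show "\<phi> * cot \<phi> * (norm (fst q - fst p))\<^sup>2 \<le> D\<^sup>2" .
qed (use assms in auto)

text \<open>The case \<open>\<phi> = pi / 2\<close>, in which the horizontal term drops out.\<close>

lemma height_le_of_cc_dist:
  assumes "0 \<le> D" "cc_dist p q \<le> ennreal D"
  shows "pi / 2 * \<bar>height p q\<bar> \<le> D\<^sup>2"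
proof -
  have "cot (pi / 2) = (0::real)" by (simp add: cot_def)
  then show ?thesis using assms by (auto simp: cc_dist_le_iff dest: spec[of _ "pi / 2"])
qed

lemma cc_dist_le_0_iff: "cc_dist p q \<le> 0 \<longleftrightarrow> p = q"
proof
  assume "cc_dist p q \<le> 0"
  then have "norm (fst q - fst p) \<le> 0" "pi / 2 * \<bar>height p q\<bar> \<le> 0\<^sup>2"
    using norm_le_of_cc_dist[of 0 p q] height_le_of_cc_dist[of 0 p q] by auto
  then have "fst p = fst q" "height p q = 0" using pi_gt_zero by (auto simp: mult_le_0_iff)
  then show "p = q" by (simp add: height_def prod_eq_iff)
next
  assume "p = q"
  then show "cc_dist p q \<le> 0"
    using cc_dist_le_iff[of 0 p q] by (simp add: height_def)
qed

lemma cc_dist_le_crude: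
  "cc_dist p q \<le> ennreal (sqrt ((norm (fst q - fst p))\<^sup>2 + pi * \<bar>height p q\<bar>))"
proof (subst cc_dist_le_iff; safe?)
  fix \<phi> :: real assume \<phi>: "0 < \<phi>" "\<phi> < pi"
  have "\<phi> * cot \<phi> \<le> 1" using cot_le_inverse[OF \<phi>] \<phi> by (simp add: field_simps)
  then have "\<phi> * cot \<phi> * (norm (fst q - fst p))\<^sup>2 \<le> 1 * (norm (fst q - fst p))\<^sup>2"
    by (intro mult_right_mono) auto
  moreover have "\<phi> * \<bar>height p q\<bar> \<le> pi * \<bar>height p q\<bar>" using \<phi> by (intro mult_right_mono) auto
  ultimately show "\<phi> * cot \<phi> * (norm (fst q - fst p))\<^sup>2 + \<phi> * \<bar>height p q\<bar>
      \<le> (sqrt ((norm (fst q - fst p))\<^sup>2 + pi * \<bar>height p q\<bar>))\<^sup>2"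
    by simp
qed simp

lemma closed_cc_dist_le:
  assumes "0 \<le> D"
  shows "closed {pq :: ('n::finite) heis \<times> 'n heis. cc_dist (fst pq) (snd pq) \<le> ennreal D}"
proof -
  have "closed {pq :: 'n heis \<times> 'n heis. \<phi> * cot \<phi> * (norm (fst (snd pq) - fst (fst pq)))\<^sup>2
      + \<phi> * \<bar>height (fst pq) (snd pq)\<bar> \<le> D\<^sup>2}" for \<phi>
    unfolding height_def by (intro closed_Collect_le continuous_intros)
  then show ?thesis
    unfolding cc_dist_le_iff[OF assms] by (intro closed_Collect_all closed_Collect_imp) (auto intro: open_Collect_const)
qed

lemma cc_diam_closure_le:
  fixes F :: "('n::finite) heis set"
  assumes "0 \<le> D" "cc_diam F \<le> ennreal D"
  shows "cc_diam (closure F) \<le> ennreal D"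
proof -
  have "F \<times> F \<subseteq> {pq. cc_dist (fst pq) (snd pq) \<le> ennreal D}"
    using assms(2) by (auto simp: cc_diam_le_iff)
  then have "closure (F \<times> F) \<subseteq> {pq. cc_dist (fst pq) (snd pq) \<le> ennreal D}"
    by (rule closure_minimal) (rule closed_cc_dist_le[OF assms(1)])
  then show ?thesis by (auto simp: closure_Times cc_diam_le_iff)
qed

lemma bounded_cc_diam_le:
  assumes "0 \<le> D" "cc_diam F \<le> ennreal D" and "p \<in> F"
  shows "bounded F"
proof -
  have "norm q \<le> (norm (fst p) + D) + (\<bar>snd p\<bar> + D\<^sup>2 + 2 * (norm (fst p) * (norm (fst p) + D)))" if "q \<in> F" for q
  proof -
    have le: "cc_dist p q \<le> ennreal D" using assms that by (auto simp: cc_diam_le_iff)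
    have n: "norm (fst q) \<le> norm (fst p) + D"
      using norm_le_of_cc_dist[OF assms(1) le] norm_triangle_sub[of "fst q" "fst p"] by linarith
    have "1 * \<bar>height p q\<bar> \<le> pi / 2 * \<bar>height p q\<bar>" using pi_gt3 by (intro mult_right_mono) auto
    then have "\<bar>height p q\<bar> \<le> D\<^sup>2" using height_le_of_cc_dist[OF assms(1) le] by linarith
    moreover have "\<bar>symp (fst p) (fst q)\<bar> \<le> norm (fst p) * (norm (fst p) + D)"
      using abs_symp_le[of "fst p" "fst q"] mult_left_mono[OF n norm_ge_zero[of "fst p"]] by linarith
    ultimately have "\<bar>snd q\<bar> \<le> \<bar>snd p\<bar> + D\<^sup>2 + 2 * (norm (fst p) * (norm (fst p) + D))"
      unfolding height_def by linarith
    then show ?thesis using n norm_Pair_le[of "fst q" "snd q"] by simp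
  qed
  then show ?thesis unfolding bounded_iff by blast
qed

lemma cc_diam_bounded_lt_top:
  assumes "bounded (F :: ('n::finite) heis set)"
  obtains D where "0 \<le> D" "cc_diam F \<le> ennreal D"
proof -
  obtain B where B: "\<And>p. p \<in> F \<Longrightarrow> norm p \<le> B" "0 < B" using assms bounded_pos by blast
  have "cc_dist p q \<le> ennreal (sqrt ((2 * B)\<^sup>2 + pi * (2 * B + 2 * (B * B))))" if "p \<in> F" "q \<in> F" for p q
  proof -
    have n: "norm (fst p) \<le> B" "norm (fst q) \<le> B" "\<bar>snd p\<bar> \<le> B" "\<bar>snd q\<bar> \<le> B"
      using B(1)[OF that(1)] B(1)[OF that(2)] norm_fst_le[of "fst p" "snd p"] norm_fst_le[of "fst q" "snd q"]
        norm_snd_le[of "snd p" "fst p"] norm_snd_le[of "snd q" "fst q"] by auto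
    have "norm (fst q - fst p) \<le> 2 * B" using n norm_triangle_ineq4[of "fst q" "fst p"] by linarith
    moreover have "\<bar>symp (fst p) (fst q)\<bar> \<le> B * B"
      using abs_symp_le[of "fst p" "fst q"] mult_mono[OF n(1,2)] \<open>0 < B\<close> by (auto intro: order_trans)
    then have "\<bar>height p q\<bar> \<le> 2 * B + 2 * (B * B)" unfolding height_def using n by linarith
    ultimately have "sqrt ((norm (fst q - fst p))\<^sup>2 + pi * \<bar>height p q\<bar>) \<le> sqrt ((2 * B)\<^sup>2 + pi * (2 * B + 2 * (B * B)))"
      by (intro real_sqrt_le_mono add_mono power_mono mult_left_mono) auto
    then show ?thesis using cc_dist_le_crude[of p q] by (meson ennreal_leI order_trans)
  qed
  then have "cc_diam F \<le> ennreal (sqrt ((2 * B)\<^sup>2 + pi * (2 * B + 2 * (B * B))))"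
    by (simp add: cc_diam_le_iff)
  then show thesis using \<open>0 < B\<close> by (intro that[OF real_sqrt_ge_zero]) auto
qed

section \<open>The isodiametric constant\<close>

lemma outer_measure_of_compact:
  "compact K \<Longrightarrow> outer_measure_of lebesgue K = emeasure lborel K" for K :: "'a::euclidean_space set"
  by (simp add: compact_imp_closed)

lemma cc_diam_pos:
  fixes K :: "('n::finite) heis set"
  assumes "0 < emeasure lborel K"
  shows "0 < cc_diam K"
proof (rule ccontr)
  assume "\<not> 0 < cc_diam K"
  then have "cc_diam K \<le> 0" by simp
  then have "p = q" if "p \<in> K" "q \<in> K" for p q
    using that cc_diam_le_iff[of K 0] cc_dist_le_0_iff by blast
  then have "K = {} \<or> (\<exists>p. K = {p})" by blast
  then show False using assms by auto
qed

lemma emeasure_le_isodiam_const: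
  fixes K :: "('n::finite) heis set"
  assumes "compact K" "0 < emeasure lborel K"
  shows "emeasure lborel K \<le> isodiam_const TYPE('n) * cc_diam K ^ (2 * CARD('n) + 2)"
proof -
  let ?d = "cc_diam K ^ (2 * CARD('n) + 2)"
  obtain D where "cc_diam K \<le> ennreal D" using cc_diam_bounded_lt_top compact_imp_bounded assms(1) by blast
  then have "cc_diam K < top" by (simp add: le_less_trans)
  have d: "?d \<noteq> 0" "?d \<noteq> top"
    using \<open>cc_diam K < top\<close> cc_diam_pos[OF assms(2)] unfolding power_eq_top_ennreal by auto
  have "emeasure lborel K / ?d \<le> isodiam_const TYPE('n)"
    unfolding isodiam_const_def outer_measure_of_compact[OF assms(1), symmetric]
    using \<open>cc_diam K < top\<close> cc_diam_pos[OF assms(2)] by (intro Sup_upper) auto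
  then have "emeasure lborel K / ?d * ?d \<le> isodiam_const TYPE('n) * ?d" by (intro mult_right_mono) auto
  moreover have "emeasure lborel K / ?d * ?d = emeasure lborel K"
    using d by (simp add: ennreal_divide_times less_top)
  ultimately show ?thesis by simp
qed

lemma isodiam_const_pos: "0 < isodiam_const TYPE('n::finite)"
proof (rule ccontr)
  assume "\<not> 0 < isodiam_const TYPE('n)"
  then have "isodiam_const TYPE('n) = 0" by simp
  moreover have "0 < emeasure lborel (cball (0 :: 'n heis) 1)"
    using content_cball_pos[OF zero_less_one, of "0 :: 'n heis"] unfolding measure_def
    by (cases "emeasure lborel (cball (0 :: 'n heis) 1) = 0") (auto simp: zero_less_iff_neq_zero)
  ultimately show False using emeasure_le_isodiam_const[of "cball (0 :: 'n heis) 1"] by simp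
qed

text \<open>Only a lower bound on the volume has to be checked, and only against an upper bound
  \<open>D\<close> of the diameter: \<open>emeasure_le_isodiam_const\<close> is the opposite
  inequality.\<close>

lemma isodiametric_setsI:
  fixes K :: "('n::finite) heis set"
  assumes "compact K" "cc_diam K \<le> ennreal D" "0 < D"
    and vol: "isodiam_const TYPE('n) * ennreal D ^ (2 * CARD('n) + 2) \<le> emeasure lborel K"
  shows "K \<in> isodiametric_sets"
proof -
  have "0 < isodiam_const TYPE('n) * ennreal D ^ (2 * CARD('n) + 2)"
    using isodiam_const_pos[where 'n = 'n] \<open>0 < D\<close> by (simp add: zero_less_iff_neq_zero)
  then have pos: "0 < emeasure lborel K" using vol by (rule less_le_trans)
  have "isodiam_const TYPE('n) * cc_diam K ^ (2 * CARD('n) + 2) \<le> emeasure lborel K"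
    using vol by (rule order_trans[rotated]) (intro mult_left_mono power_mono assms(2); simp)
  then show ?thesis
    unfolding isodiametric_sets_def
    using assms(1) cc_diam_pos[OF pos] emeasure_le_isodiam_const[OF assms(1) pos]
    by (simp add: outer_measure_of_compact del: outer_measure_of_eq)
qed

section \<open>Existence of isodiametric sets\<close>

text \<open>Taking the closure keeps the diameter bound. Moving a point of \<open>F\<close> to the
  origin and dilating by \<open>1 / d\<close> then preserves the quotient, because volume scales
  with the exponent \<open>2 * CARD('n) + 2\<close>.\<close>

lemma finite_cc_diam_normalise:
  fixes F :: "('n::finite) heis set"
  assumes "0 < cc_diam F" "cc_diam F < top"
  obtains K :: "'n heis set" where "compact K" "0 \<in> K" "cc_diam K \<le> 1"
    "outer_measure_of lebesgue F / cc_diam F ^ (2 * CARD('n) + 2) \<le> emeasure lborel K"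
proof -
  obtain d where d: "cc_diam F = ennreal d" "0 < d"
    using assms by (cases "cc_diam F") auto
  have "F \<noteq> {}" using assms(1) by (auto simp: cc_diam_def)
  then obtain p where "p \<in> F" by blast
  define C where "C = closure F"
  have C_diam: "cc_diam C \<le> ennreal d"
    unfolding C_def using d by (intro cc_diam_closure_le) auto
  have "compact C"
    unfolding C_def using bounded_cc_diam_le[of d F p] \<open>p \<in> F\<close> d by (simp add: bounded_closure compact_closure)
  \<comment> \<open>The dilation after the translation, written in the shape required by
    \<open>emeasure_affine_shear\<close>.\<close>
  define T where "T q = ((- 1 / d) *\<^sub>R fst p + (1 / d) *\<^sub>R fst q,
      (1 / d)\<^sup>2 * (- snd p - 2 * symp (fst p) (fst q)) + (1 / d)\<^sup>2 * snd q)" for q :: "'n heis"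
  have T: "T q = heis_dil (1 / d) (heis_mult (- p) q)" for q
    by (simp add: T_def heis_dil_def heis_mult_symp algebra_simps)
  have cont: "continuous_on UNIV (\<lambda>z. (1 / d)\<^sup>2 * (- snd p - 2 * symp (fst p) z))"
    by (intro continuous_intros)
  show thesis
  proof (rule that[of "T ` C"])
    show "compact (T ` C)"
      unfolding T_def by (rule emeasure_affine_shear(1)[OF \<open>compact C\<close> _ _ cont]) (use d in auto)
    have "T p = 0" by (simp add: T_def prod_eq_iff algebra_simps)
    moreover have "p \<in> C" using \<open>p \<in> F\<close> closure_subset by (auto simp: C_def)
    ultimately show "0 \<in> T ` C" by (metis image_eqI)
    have "cc_dist (T x) (T y) \<le> ennreal (1 / d * d)" if "x \<in> C" "y \<in> C" for x y
      unfolding T using d that C_diam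
      by (intro cc_dist_heis_dil_le) (auto simp: cc_dist_heis_mult_le cc_diam_le_iff)
    then show "cc_diam (T ` C) \<le> 1" using d by (auto simp: cc_diam_le_iff)
    have "emeasure lborel (T ` C) = ennreal ((1 / d) ^ DIM(complex ^ 'n) * (1 / d)\<^sup>2) * emeasure lborel C"
      unfolding T_def by (rule emeasure_affine_shear(2)[OF \<open>compact C\<close> _ _ cont]) (use d in auto)
    also have "(1 / d) ^ DIM(complex ^ 'n) * (1 / d)\<^sup>2 = 1 / d ^ (2 * CARD('n) + 2)"
      by (simp add: power_add power_one_over power2_eq_square mult.commute)
    finally have T_vol: "emeasure lborel (T ` C) = ennreal (1 / d ^ (2 * CARD('n) + 2)) * emeasure lborel C" .
    have "outer_measure_of lebesgue F \<le> emeasure lborel C"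
      using outer_measure_of_mono[OF closure_subset[of F], of lebesgue] outer_measure_of_compact[OF \<open>compact C\<close>]
      by (simp only: C_def)
    then have "outer_measure_of lebesgue F / cc_diam F ^ (2 * CARD('n) + 2)
        \<le> emeasure lborel C / cc_diam F ^ (2 * CARD('n) + 2)"
      by (rule divide_right_mono_ennreal)
    also have "\<dots> = emeasure lborel (T ` C)"
    proof -
      have "inverse (ennreal d ^ (2 * CARD('n) + 2)) = ennreal (1 / d ^ (2 * CARD('n) + 2))"
        using d(2) inverse_ennreal[of "d ^ (2 * CARD('n) + 2)"]
        by (simp only: ennreal_power less_imp_le zero_less_power inverse_eq_divide)
      then show ?thesis
        unfolding T_vol d(1) divide_ennreal_def by (simp only: mult.commute)
    qed
    finally show "outer_measure_of lebesgue F / cc_diam F ^ (2 * CARD('n) + 2) \<le> emeasure lborel (T ` C)" .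
  qed
qed

text \<open>
  Blaschke selection: the distance functions of a maximising sequence converge uniformly along a
  subsequence, and the zero set of the limit is isodiametric.
\<close>

theorem isodiametric_set_exists: "\<exists>K :: ('n::finite) heis set. K \<in> isodiametric_sets"
proof -
  let ?Q = "2 * CARD('n) + 2"
  let ?C = "isodiam_const TYPE('n)"
  let ?S = "{outer_measure_of lebesgue F / cc_diam F ^ ?Q | F :: 'n heis set. 0 < cc_diam F \<and> cc_diam F < top}"
  have "?S \<noteq> {}"
  proof
    assume "?S = {}"
    then have "?C = 0" unfolding isodiam_const_def by (simp only: Sup_empty bot_ennreal)
    then show False using isodiam_const_pos[where 'n = 'n] by simp
  qed
  from ennreal_Sup_countable_SUP[OF this] obtain x :: "nat \<Rightarrow> ennreal"
    where x: "incseq x" "range x \<subseteq> ?S" "?C = (SUP i. x i)"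
    unfolding isodiam_const_def by blast
  have "\<exists>K :: 'n heis set. compact K \<and> 0 \<in> K \<and> cc_diam K \<le> 1 \<and> x i \<le> emeasure lborel K" for i
  proof -
    obtain F :: "'n heis set" where "0 < cc_diam F" "cc_diam F < top"
      "x i = outer_measure_of lebesgue F / cc_diam F ^ ?Q"
      using x(2) by blast
    then show ?thesis using finite_cc_diam_normalise[of F] by metis
  qed
  then obtain E :: "nat \<Rightarrow> 'n heis set" where E: "\<And>i. compact (E i)" "\<And>i. 0 \<in> E i"
    "\<And>i. cc_diam (E i) \<le> 1" "\<And>i. x i \<le> emeasure lborel (E i)"
    by metis
  have "bounded (\<Union>i. E i)"
  proof -
    have "bounded {q :: 'n heis. norm (fst q) \<le> 1 \<and> \<bar>snd q\<bar> \<le> 1}"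
    proof -
      have "norm q \<le> 2" if "norm (fst q) \<le> 1" "\<bar>snd q\<bar> \<le> 1" for q :: "'n heis"
        using that norm_Pair_le[of "fst q" "snd q"] by simp
      then show ?thesis unfolding bounded_iff by blast
    qed
    moreover have "norm (fst q) \<le> 1 \<and> \<bar>snd q\<bar> \<le> 1" if "q \<in> E i" for q i
    proof -
      have d: "cc_dist 0 q \<le> ennreal 1" using E(2,3)[of i] that by (auto simp: cc_diam_le_iff)
      have "1 * \<bar>snd q\<bar> \<le> pi / 2 * \<bar>snd q\<bar>" using pi_gt3 by (intro mult_right_mono) auto
      also have "\<dots> \<le> 1" using height_le_of_cc_dist[OF _ d] by (simp add: height_def)
      finally show ?thesis using norm_le_of_cc_dist[OF _ d] by simp
    qed
    ultimately show ?thesis by (auto elim: bounded_subset)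
  qed
  then obtain R where R: "0 < R" "\<forall>z\<in>(\<Union>i. E i). norm z \<le> R"
    unfolding bounded_pos by blast
  define B where "B = cball (0 :: 'n heis) R"
  have "compact B" by (simp add: B_def)
  have E_sub: "E i \<subseteq> B" for i using R by (auto simp: B_def)
  \<comment> \<open>Distance functions are 1-Lipschitz, and bounded by \<open>R\<close> on
    \<open>B\<close> because every \<open>E i\<close> contains the origin.\<close>
  obtain g k where g: "continuous_on B g" "strict_mono (k :: nat \<Rightarrow> nat)"
    "\<And>e. 0 < e \<Longrightarrow> \<exists>N. \<forall>n z. n \<ge> N \<and> z \<in> B \<longrightarrow> norm (infdist z (E (k n)) - g z) < e"
  proof (rule Arzela_Ascoli[OF \<open>compact B\<close>, of "\<lambda>i z. infdist z (E i)" R])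
    fix i and z :: "'n heis" assume "z \<in> B"
    then show "norm (infdist z (E i)) \<le> R"
      using infdist_le[OF E(2)[of i], of z] infdist_nonneg[of z "E i"] by (simp add: B_def dist_commute)
  next
    fix z :: "'n heis" and e :: real assume "0 < e"
    have "norm (infdist z (E n) - infdist y (E n)) < e" if "norm (z - y) < e" for n y
      using infdist_triangle_abs[of z "E n" y] that by (simp add: dist_norm)
    then show "\<exists>d>0. \<forall>n y. y \<in> B \<and> norm (z - y) < d \<longrightarrow> norm (infdist z (E n) - infdist y (E n)) < e"
      using \<open>0 < e\<close> by blast
  qed blast
  \<comment> \<open>Uniform convergence puts all late sets \<open>E (k n)\<close> inside
    \<open>G m\<close>. So each \<open>G m\<close> has volume at least \<open>?C\<close>, while the
    diameter bound survives in the intersection.\<close>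
  define G where "G m = {z \<in> B. g z \<le> 1 / real (Suc m)}" for m
  define K where "K = (\<Inter>m. G m)"
  have G_closed: "compact (G m)" for m
  proof -
    have "closed (B \<inter> g -` {..1 / real (Suc m)})"
      using g(1) \<open>compact B\<close> by (intro continuous_closed_preimage) (auto simp: compact_imp_closed)
    moreover have "G m = B \<inter> g -` {..1 / real (Suc m)}" by (auto simp: G_def)
    ultimately show ?thesis using \<open>compact B\<close> by (metis compact_Int_closed inf.left_idem)
  qed
  have "closed K" unfolding K_def using G_closed by (intro closed_INT ballI) (simp add: compact_imp_closed)
  then have "compact (G 0 \<inter> K)" using G_closed by (rule compact_Int_closed[rotated])
  moreover have "G 0 \<inter> K = K" by (auto simp: K_def)
  ultimately have "compact K" by simp
  have near: "\<exists>y\<in>E (k n). dist z y < e" if "infdist z (E (k n)) < e" for z n e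
    using infdist_attains_inf[of "E (k n)" z] E(1)[of "k n"] E(2)[of "k n"] that
    by (metis compact_imp_closed empty_iff)
  have "cc_dist p q \<le> ennreal 1" if pq: "p \<in> K" "q \<in> K" for p q
  proof -
    have gK: "g z \<le> 0" if "z \<in> K" for z
    proof (rule field_le_epsilon)
      fix e :: real assume "0 < e"
      then obtain m where "1 / real (Suc m) < e" using nat_approx_posE by blast
      moreover have "g z \<le> 1 / real (Suc m)" using that by (auto simp: K_def G_def)
      ultimately show "g z \<le> 0 + e" by simp
    qed
    \<comment> \<open>Every pair in \<open>K\<close> is a limit of pairs taken from single sets
      \<open>E (k N)\<close>, and the distance condition on pairs is closed.\<close>
    have "(p, q) \<in> closure {pq. cc_dist (fst pq) (snd pq) \<le> ennreal 1}"
      unfolding closure_approachable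
    proof (intro allI impI)
      fix e :: real assume "0 < e"
      obtain N where N: "\<And>n z. N \<le> n \<Longrightarrow> z \<in> B \<Longrightarrow> norm (infdist z (E (k n)) - g z) < e / 2"
        using g(3)[of "e / 2"] \<open>0 < e\<close> by auto
      have "infdist z (E (k N)) < e / 2" if "z \<in> K" for z
      proof -
        have "z \<in> B" using that by (auto simp: K_def G_def)
        then show ?thesis using N[of N z] gK[OF that] by (auto simp: abs_if split: if_splits)
      qed
      then obtain p' q' where p'q': "p' \<in> E (k N)" "q' \<in> E (k N)" "dist p p' < e / 2" "dist q q' < e / 2"
        using near pq by meson
      have "dist (p', q') (p, q) \<le> dist p' p + dist q' q"
        unfolding dist_Pair_Pair by (rule sqrt_sum_squares_le_sum) auto
      also have "\<dots> < e" using p'q' by (simp add: dist_commute)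
      finally have "dist (p', q') (p, q) < e" .
      moreover have "cc_dist p' q' \<le> ennreal 1"
        using E(3)[of "k N"] p'q' by (auto simp: cc_diam_le_iff)
      ultimately show "\<exists>y\<in>{pq. cc_dist (fst pq) (snd pq) \<le> ennreal 1}. dist y (p, q) < e"
        by (intro bexI[of _ "(p', q')"]) auto
    qed
    then show ?thesis using closed_cc_dist_le[of 1, where 'n = 'n] by (simp add: closure_closed)
  qed
  then have "cc_diam K \<le> ennreal 1" by (simp only: cc_diam_le_iff) blast
  moreover have "?C \<le> emeasure lborel K"
  proof -
    have "?C \<le> emeasure lborel (G m)" for m
    proof -
      obtain N where N: "\<And>n z. N \<le> n \<Longrightarrow> z \<in> B \<Longrightarrow> norm (infdist z (E (k n)) - g z) < 1 / real (Suc m)"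
        using g(3)[of "1 / real (Suc m)"] by auto
      have "x i \<le> emeasure lborel (G m)" for i
      proof -
        define n where "n = max i N"
        have "E (k n) \<subseteq> G m"
        proof
          fix z assume z: "z \<in> E (k n)"
          then have "z \<in> B" using E_sub by blast
          with N[of n z] z show "z \<in> G m" by (auto simp: G_def n_def abs_if split: if_splits)
        qed
        then have "emeasure lborel (E (k n)) \<le> emeasure lborel (G m)"
          using G_closed[of m] by (intro emeasure_mono) (auto simp: compact_imp_closed)
        moreover have "x i \<le> x (k n)"
          using seq_suble[OF g(2), of n] x(1) by (intro incseqD[OF x(1)]) (simp add: n_def)
        ultimately show ?thesis using E(4)[of "k n"] by (meson order_trans)
      qed
      then show ?thesis unfolding x(3) by (intro SUP_least)
    qed
    then have "?C \<le> (INF m. emeasure lborel (G m))" by (intro INF_greatest)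
    \<comment> \<open>Continuity from above; compactness of the \<open>G m\<close> supplies the
      finite measure it needs.\<close>
    also have "\<dots> = emeasure lborel K"
      unfolding K_def
    proof (rule INF_emeasure_decseq)
      show "range G \<subseteq> sets lborel" using G_closed by (auto simp: compact_imp_closed)
      show "decseq G"
      proof (rule decseq_SucI)
        fix m
        have "1 / real (Suc (Suc m)) \<le> 1 / real (Suc m)" by (simp add: frac_le)
        then show "G (Suc m) \<subseteq> G m" unfolding G_def by (auto intro: order_trans)
      qed
      show "emeasure lborel (G m) \<noteq> \<infinity>" for m
        using emeasure_compact_finite[OF G_closed[of m]] by auto
    qed
    finally show ?thesis .
  qed
  ultimately have "K \<in> isodiametric_sets"
    using \<open>compact K\<close> by (intro isodiametric_setsI[of K 1]) auto
  then show ?thesis by blast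
qed

section \<open>Hulls of balls and their shears\<close>

text \<open>
  The convex hull of the ball of radius \<open>r\<close>: the ball itself is cut out by all \<open>\<phi> < pi\<close>, and dropping
  \<open>\<phi> > pi / 2\<close> fills the dimples at its poles by flat discs. The bound on \<open>snd\<close> is the case \<open>\<phi> = pi / 2\<close>.
\<close>

definition lens :: "real \<Rightarrow> ('n::finite) heis set" where
  "lens r = {p. norm (fst p) \<le> r \<and> pi * \<bar>snd p\<bar> \<le> 2 * r\<^sup>2 \<and>
     (\<forall>\<phi>. 0 < \<phi> \<and> \<phi> < pi / 2 \<longrightarrow> \<phi> * cot \<phi> * (norm (fst p))\<^sup>2 + \<phi> * \<bar>snd p\<bar> \<le> r\<^sup>2)}"

lemma compact_lens: "compact (lens r :: ('n::finite) heis set)"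
  unfolding compact_eq_bounded_closed
proof
  have "norm p \<le> r + 2 * r\<^sup>2" if "p \<in> lens r" for p :: "'n heis"
  proof -
    have "1 * \<bar>snd p\<bar> \<le> pi * \<bar>snd p\<bar>" using pi_gt3 by (intro mult_right_mono) auto
    then show ?thesis using that norm_Pair_le[of "fst p" "snd p"] by (auto simp: lens_def)
  qed
  then show "bounded (lens r :: 'n heis set)" unfolding bounded_iff by blast
  show "closed (lens r :: 'n heis set)"
    unfolding lens_def
    by (intro closed_Collect_conj closed_Collect_all closed_Collect_imp closed_Collect_le continuous_intros)
      (auto intro: open_Collect_const)
qed

lemma lens_vertical_mono:
  assumes "(z, h) \<in> lens r" "\<bar>t\<bar> \<le> h"
  shows "(z, t) \<in> lens r"
proof -
  have mono: "x * \<bar>t\<bar> \<le> x * \<bar>h\<bar>" if "0 < x" for x :: real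
    using assms(2) that by (intro mult_left_mono) auto
  have h: "norm z \<le> r" "pi * \<bar>h\<bar> \<le> 2 * r\<^sup>2"
    "\<And>\<phi>. 0 < \<phi> \<Longrightarrow> \<phi> < pi / 2 \<Longrightarrow> \<phi> * cot \<phi> * (norm z)\<^sup>2 + \<phi> * \<bar>h\<bar> \<le> r\<^sup>2"
    using assms(1) by (auto simp: lens_def)
  have "\<phi> * cot \<phi> * (norm z)\<^sup>2 + \<phi> * \<bar>t\<bar> \<le> r\<^sup>2" if "0 < \<phi>" "\<phi> < pi / 2" for \<phi>
    using h(3)[OF that] mono[OF that(1)] by linarith
  moreover have "pi * \<bar>t\<bar> \<le> 2 * r\<^sup>2" using h(2) mono[OF pi_gt_zero] by linarith
  ultimately show ?thesis using h(1) by (simp add: lens_def)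
qed

lemma half_le_sin:
  assumes "0 < x" "x < pi / 2"
  shows "x / 2 \<le> sin x"
proof (cases "x \<le> pi / 3")
  case True
  have "1 / 2 \<le> cos x" using cos_monotone_0_pi_le[of x "pi / 3"] assms True by (simp add: cos_60)
  then have "x * (1 / 2) \<le> x * cos x" using assms by (intro mult_left_mono) auto
  also have "\<dots> \<le> sin x"
    using cot_le_inverse[of x] assms sin_gt_zero[of x] by (simp add: cot_def field_simps)
  finally show ?thesis by simp
next
  case False
  \<comment> \<open>The number \<open>8 / 10\<close> separates \<open>pi / 4\<close>, which exceeds
    \<open>x / 2\<close>, from \<open>sin (pi / 3)\<close>.\<close>
  have "8 / 10 \<le> sqrt 3 / (2 :: real)" by (rule power2_le_imp_le) (auto simp: power_divide)
  also have "sqrt 3 / 2 = sin (pi / 3)" by (simp add: sin_60)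
  also have "\<dots> \<le> sin x" using False assms by (intro sin_monotone_2pi_le) auto
  finally show ?thesis using assms pi_less_4 pi_approx by simp
qed

text \<open>Quantitative flatness: near the axis the inequality at \<open>pi / 2\<close> implies all
  others with room to spare. The vertical term leaves at least
  \<open>cos \<phi> * r\<^sup>2 / 2\<close>, and the horizontal term uses up at most
  \<open>cos \<phi> * r\<^sup>2 / 32\<close>.\<close>

lemma lens_slack:
  assumes \<phi>: "0 < \<phi>" "\<phi> < pi / 2" and "0 \<le> \<rho>" "\<rho> \<le> r / 8" "pi * \<bar>t\<bar> \<le> 2 * r\<^sup>2"
  shows "cos \<phi> * r\<^sup>2 / 4 \<le> r\<^sup>2 - (\<phi> * cot \<phi> * \<rho>\<^sup>2 + \<phi> * \<bar>t\<bar>)"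
proof -
  have s: "0 < sin \<phi>" and c: "0 < cos \<phi>" using \<phi> by (auto intro: sin_gt_zero cos_gt_zero)
  have le1: "\<phi> * cot \<phi> \<le> 2 * cos \<phi>"
  proof -
    have "\<phi> / sin \<phi> \<le> 2" using half_le_sin[OF \<phi>] s by (simp add: field_simps)
    then have "\<phi> / sin \<phi> * cos \<phi> \<le> 2 * cos \<phi>" using c by (intro mult_right_mono) auto
    then show ?thesis by (simp add: cot_def)
  qed
  have le2: "\<rho>\<^sup>2 \<le> r\<^sup>2 / 64" using power_mono[OF assms(4,3), of 2] by (simp add: power_divide)
  have 1: "\<phi> * cot \<phi> * \<rho>\<^sup>2 \<le> 2 * cos \<phi> * (r\<^sup>2 / 64)"
    by (rule mult_mono[OF le1 le2]) (use c in auto)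
  have "\<phi> * (pi * \<bar>t\<bar>) \<le> \<phi> * (2 * r\<^sup>2)" using assms \<phi> by (intro mult_left_mono) auto
  then have 2: "\<phi> * \<bar>t\<bar> \<le> (2 * \<phi> / pi) * r\<^sup>2" by (simp add: field_simps)
  have "cos \<phi> \<le> (pi / 2 - \<phi>) * 1" using sin_x_le_x[of "pi / 2 - \<phi>"] \<phi> unfolding cos_sin_eq by simp
  also have "\<dots> \<le> (pi / 2 - \<phi>) * (4 / pi)"
    using \<phi> pi_less_4 by (intro mult_left_mono) auto
  also have "\<dots> = 2 * (1 - 2 * \<phi> / pi)" by (simp add: field_simps)
  finally have "cos \<phi> / 2 \<le> 1 - 2 * \<phi> / pi" by simp
  then have "cos \<phi> / 2 * r\<^sup>2 \<le> (1 - 2 * \<phi> / pi) * r\<^sup>2" by (intro mult_right_mono) auto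
  then have "cos \<phi> / 2 * r\<^sup>2 \<le> r\<^sup>2 - (2 * \<phi> / pi) * r\<^sup>2" by (simp add: algebra_simps)
  moreover have "0 \<le> cos \<phi> * r\<^sup>2" using c by simp
  ultimately show ?thesis using 1 2 by linarith
qed

text \<open>
  Vanishes exactly when \<open>z\<close> and \<open>w\<close> are the end points of an arc that turns by \<open>4 \<phi>\<close> and has
  its midpoint at the origin (\<open>w = - cis (\<plusminus> 2 \<phi>) z\<close>).
\<close>

definition arc_defect :: "real \<Rightarrow> complex ^ ('n::finite) \<Rightarrow> complex ^ 'n \<Rightarrow> real" where
  "arc_defect \<phi> z w = (norm z)\<^sup>2 + (norm w)\<^sup>2 + 2 * inner z w * cos (2 * \<phi>) - 2 * \<bar>symp z w\<bar> * sin (2 * \<phi>)"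

lemma arc_defect_commute: "arc_defect \<phi> w z = arc_defect \<phi> z w"
  by (simp add: arc_defect_def inner_commute symp_commute[of w z])

lemma arc_defect_eq:
  assumes "\<epsilon> = (if symp z w < 0 then -1 else 1)"
  shows "arc_defect \<phi> z w = (norm (cis (\<epsilon> * (2 * \<phi>)) *s z + w))\<^sup>2"
proof -
  have "(norm (cis (\<epsilon> * (2 * \<phi>)) *s z + w))\<^sup>2
      = (norm (cis (\<epsilon> * (2 * \<phi>)) *s z))\<^sup>2 + 2 * inner (cis (\<epsilon> * (2 * \<phi>)) *s z) w + (norm w)\<^sup>2"
    unfolding power2_norm_eq_inner by (simp add: inner_add_left inner_add_right inner_commute)
  also have "\<dots> = arc_defect \<phi> z w"
    by (auto simp: arc_defect_def norm_complex_scale inner_complex_scale assms)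
  finally show ?thesis by simp
qed

lemma arc_defect_nonneg: "0 \<le> arc_defect \<phi> z w"
  unfolding arc_defect_eq[OF refl] by simp

text \<open>The defect is the squared norm of \<open>k *s z + w\<close> with a unit \<open>k\<close>
  for which \<open>cmod (k + 1) = 2 * cos \<phi>\<close>. This vector differs from
  \<open>w - z\<close> by \<open>(k + 1) *s z\<close>, whose norm is at most half of
  \<open>norm (z - w)\<close> by hypothesis.\<close>

lemma arc_defect_lower_bound:
  assumes "0 \<le> cos \<phi>" "4 * cos \<phi> * norm z \<le> norm (z - w)"
  shows "(norm (z - w))\<^sup>2 / 4 \<le> arc_defect \<phi> z w"
proof -
  define \<epsilon> :: real where "\<epsilon> = (if symp z w < 0 then -1 else 1)"
  let ?k = "cis (\<epsilon> * (2 * \<phi>))"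
  have "(cmod (?k + 1))\<^sup>2 = (2 * cos \<phi>)\<^sup>2"
  proof -
    have "(cmod (?k + 1))\<^sup>2 = 2 + 2 * cos (2 * \<phi>)"
      using sin_cos_squared_add[of "2 * \<phi>"] unfolding cmod_power2
      by (auto simp: \<epsilon>_def power2_eq_square algebra_simps)
    then show ?thesis by (simp add: cos_double_cos power_mult_distrib)
  qed
  then have k: "cmod (?k + 1) = 2 * cos \<phi>" by (rule power2_eq_imp_eq) (use assms in auto)
  have "z - w = (?k + 1) *s z - (?k *s z + w)" by (simp add: vector_sadd_rdistrib)
  then have "norm (z - w) \<le> norm ((?k + 1) *s z) + norm (?k *s z + w)"
    by (metis norm_triangle_ineq4)
  then have "norm (z - w) \<le> 2 * cos \<phi> * norm z + norm (?k *s z + w)"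
    by (simp only: norm_complex_scale k)
  then have "norm (z - w) / 2 \<le> norm (?k *s z + w)" using assms(2) by simp
  then have "(norm (z - w) / 2)\<^sup>2 \<le> (norm (?k *s z + w))\<^sup>2" by (intro power_mono) auto
  then show ?thesis by (simp add: arc_defect_eq[OF \<epsilon>_def] power_divide)
qed

text \<open>Doubling the angle turns the inequalities defining \<open>lens r\<close> into those of the ball of radius \<open>2 r\<close>.\<close>

lemma double_angle_bound:
  assumes \<phi>: "0 < \<phi>" "\<phi> < pi / 2"
    and \<tau>: "\<bar>\<tau>\<bar> \<le> \<bar>t\<bar> + \<bar>u\<bar> + 2 * \<bar>symp z w\<bar> + \<delta>"
    and \<sigma>: "\<phi> * cot \<phi> * (norm z)\<^sup>2 + \<phi> * \<bar>t\<bar> = R - \<sigma>" "\<phi> * cot \<phi> * (norm w)\<^sup>2 + \<phi> * \<bar>u\<bar> = R - \<sigma>'"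
    and \<delta>: "\<phi> * (\<delta> * sin (2 * \<phi>)) \<le> \<phi> * arc_defect \<phi> z w + (\<sigma> + \<sigma>') * sin (2 * \<phi>)"
  shows "2 * \<phi> * cot (2 * \<phi>) * (norm (w - z))\<^sup>2 + 2 * \<phi> * \<bar>\<tau>\<bar> \<le> 4 * R"
proof -
  define s where "s = sin \<phi>"
  define c where "c = cos \<phi>"
  have s: "0 < s" and c: "0 < c" using \<phi> by (auto simp: s_def c_def intro: sin_gt_zero cos_gt_zero)
  have one: "c\<^sup>2 = 1 - s\<^sup>2" by (simp add: s_def c_def cos_squared_eq)
  have sc: "0 < s * c" using s c by simp
  have diff: "(norm (w - z))\<^sup>2 = (norm z)\<^sup>2 + (norm w)\<^sup>2 - 2 * inner z w"
    unfolding power2_norm_eq_inner by (simp add: inner_diff_left inner_diff_right inner_commute)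
  have cot2: "cot (2 * \<phi>) = (c\<^sup>2 - s\<^sup>2) / (2 * (s * c))"
    by (simp add: cot_def sin_double cos_double s_def c_def)
  have cot1: "cot \<phi> = c / s" by (simp add: cot_def s_def c_def)
  have "2 * \<phi> * \<bar>\<tau>\<bar> \<le> 2 * \<phi> * (\<bar>t\<bar> + \<bar>u\<bar> + 2 * \<bar>symp z w\<bar> + \<delta>)"
    using \<tau> \<phi> by (intro mult_left_mono) auto
  also have "\<dots> = 2 * (R - \<sigma> - \<phi> * cot \<phi> * (norm z)\<^sup>2) + 2 * (R - \<sigma>' - \<phi> * cot \<phi> * (norm w)\<^sup>2)
      + 4 * \<phi> * \<bar>symp z w\<bar> + 2 * \<phi> * \<delta>"
    using \<sigma> by (simp add: algebra_simps)
  \<comment> \<open>Multiplying by \<open>sin \<phi> * cos \<phi>\<close> clears the denominators of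
    both cotangents.\<close>
  finally have "2 * \<phi> * \<bar>\<tau>\<bar> * (s * c) \<le> (2 * (R - \<sigma> - \<phi> * cot \<phi> * (norm z)\<^sup>2) + 2 * (R - \<sigma>' - \<phi> * cot \<phi> * (norm w)\<^sup>2)
      + 4 * \<phi> * \<bar>symp z w\<bar> + 2 * \<phi> * \<delta>) * (s * c)"
    using sc by (intro mult_right_mono) auto
  also have "\<dots> = 4 * R * (s * c) - 2 * (\<sigma> + \<sigma>') * (s * c) - 2 * \<phi> * c\<^sup>2 * ((norm z)\<^sup>2 + (norm w)\<^sup>2)
      + 4 * \<phi> * \<bar>symp z w\<bar> * (s * c) + 2 * \<phi> * \<delta> * (s * c)"
    unfolding cot1 using s by (simp add: field_simps power2_eq_square)
  finally have 1: "2 * \<phi> * \<bar>\<tau>\<bar> * (s * c) \<le> \<dots>" .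
  have 2: "2 * \<phi> * cot (2 * \<phi>) * (norm (w - z))\<^sup>2 * (s * c) = \<phi> * (c\<^sup>2 - s\<^sup>2) * ((norm z)\<^sup>2 + (norm w)\<^sup>2 - 2 * inner z w)"
    unfolding cot2 diff using s c by (simp add: field_simps)
  have Q: "arc_defect \<phi> z w = (norm z)\<^sup>2 + (norm w)\<^sup>2 + 2 * inner z w * (c\<^sup>2 - s\<^sup>2) - 4 * \<bar>symp z w\<bar> * (s * c)"
    by (simp add: arc_defect_def cos_double sin_double s_def c_def)
  have sin2: "sin (2 * \<phi>) = 2 * (s * c)" by (simp add: sin_double s_def c_def)
  have 3: "2 * \<phi> * \<delta> * (s * c) \<le> \<phi> * ((norm z)\<^sup>2 + (norm w)\<^sup>2 + 2 * inner z w * (c\<^sup>2 - s\<^sup>2)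
      - 4 * \<bar>symp z w\<bar> * (s * c)) + 2 * (\<sigma> + \<sigma>') * (s * c)"
    using \<delta> unfolding Q sin2 by (simp add: algebra_simps)
  \<comment> \<open>The quadratic terms of \<open>1\<close> and \<open>2\<close> add up to
    \<open>- \<phi> * arc_defect \<phi> z w\<close>; by \<open>3\<close> this and the slacks absorb
    \<open>\<delta>\<close>.\<close>
  have "(2 * \<phi> * cot (2 * \<phi>) * (norm (w - z))\<^sup>2 + 2 * \<phi> * \<bar>\<tau>\<bar>) * (s * c) \<le> 4 * R * (s * c)"
    using 1 2 3 unfolding one by (simp add: algebra_simps)
  then show ?thesis using sc by (rule mult_right_le_imp_le)
qed

text \<open>A cone of slope \<open>r / 4\<close> over the ball of radius \<open>r / 16\<close> about
  \<open>z0\<close>. For \<open>norm z0 = r / 16\<close> its support stays within distance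
  \<open>r / 8\<close> of the axis, the range of \<open>lens_slack\<close>, and misses
  \<open>- z0\<close>.\<close>

definition bump :: "complex ^ ('n::finite) \<Rightarrow> real \<Rightarrow> complex ^ 'n \<Rightarrow> real" where
  "bump z0 r z = r / 4 * max 0 (r / 16 - norm (z - z0))"

text \<open>The neutral summand and factors match the map in
  \<open>emeasure_affine_shear\<close>.\<close>

definition sheared_lens :: "complex ^ ('n::finite) \<Rightarrow> real \<Rightarrow> 'n heis set" where
  "sheared_lens z0 r = (\<lambda>p. (0 + 1 *\<^sub>R fst p, bump z0 r (fst p) + 1 * snd p)) ` lens r"

lemma bump_lipschitz:
  assumes "0 \<le> r" shows "\<bar>bump z0 r z - bump z0 r w\<bar> \<le> r / 4 * norm (z - w)"
proof -
  have "\<bar>max 0 (r / 16 - norm (z - z0)) - max 0 (r / 16 - norm (w - z0))\<bar> \<le> norm (z - w)"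
    using norm_triangle_ineq3[of "z - z0" "w - z0"] by (auto simp: max_def abs_if split: if_splits)
  then have "r / 4 * \<bar>max 0 (r / 16 - norm (z - z0)) - max 0 (r / 16 - norm (w - z0))\<bar> \<le> r / 4 * norm (z - w)"
    using assms by (intro mult_left_mono) auto
  then show ?thesis
    unfolding bump_def right_diff_distrib[symmetric] abs_mult using assms by simp
qed

lemma bump_eq_0:
  assumes "norm z0 = r / 16" "r / 8 < norm z"
  shows "bump z0 r z = 0"
  using norm_triangle_ineq2[of z z0] assms by (simp add: bump_def max_def)

text \<open>Supplies the hypothesis on \<open>\<delta>\<close> in \<open>double_angle_bound\<close>.
  One point near the axis is enough: its slack alone serves, and \<open>w\<close> is
  arbitrary.\<close>

lemma bump_shear_admissible:
  assumes "0 < r" and z0: "norm z0 = r / 16" and \<phi>: "0 < \<phi>" "\<phi> < pi / 2"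
    and z: "norm z \<le> r / 8" "pi * \<bar>t\<bar> \<le> 2 * r\<^sup>2" "\<phi> * cot \<phi> * (norm z)\<^sup>2 + \<phi> * \<bar>t\<bar> = r\<^sup>2 - \<sigma>"
  shows "\<phi> * (\<bar>bump z0 r z - bump z0 r w\<bar> * sin (2 * \<phi>)) \<le> \<phi> * arc_defect \<phi> z w + \<sigma> * sin (2 * \<phi>)"
proof -
  define d where "d = norm (z - w)"
  define c where "c = cos \<phi>"
  have s: "0 < sin \<phi>" "sin \<phi> \<le> 1" and c: "0 < c"
    using \<phi> by (auto simp: c_def intro: sin_gt_zero cos_gt_zero)
  have sin2: "sin (2 * \<phi>) = 2 * (sin \<phi> * c)" by (simp add: sin_double c_def)
  have "\<bar>bump z0 r z - bump z0 r w\<bar> * sin (2 * \<phi>) \<le> (r / 4 * d) * (2 * c)"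
  proof (rule mult_mono)
    show "\<bar>bump z0 r z - bump z0 r w\<bar> \<le> r / 4 * d"
      using bump_lipschitz[of r z0 z w] \<open>0 < r\<close> by (simp add: d_def)
    have "sin \<phi> * c \<le> 1 * c" using s c by (intro mult_right_mono) auto
    then show "sin (2 * \<phi>) \<le> 2 * c" unfolding sin2 by simp
    show "0 \<le> r / 4 * d" using \<open>0 < r\<close> by (simp add: d_def)
    show "0 \<le> sin (2 * \<phi>)" unfolding sin2 using s c by simp
  qed
  also have "\<dots> \<le> arc_defect \<phi> z w + c\<^sup>2 * r\<^sup>2 / 4"
  proof (cases "4 * c * norm z \<le> d")
    case True
    \<comment> \<open>The slope \<open>r / 4\<close> is the largest for which this square
      suffices.\<close>
    have "0 \<le> (d - c * r)\<^sup>2" by simp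
    then have "(r / 4 * d) * (2 * c) \<le> d\<^sup>2 / 4 + c\<^sup>2 * r\<^sup>2 / 4"
      by (simp add: power2_diff power_mult_distrib algebra_simps)
    also have "d\<^sup>2 / 4 \<le> arc_defect \<phi> z w"
      using arc_defect_lower_bound[of \<phi> z w] True c by (simp add: d_def c_def)
    finally show ?thesis by simp
  next
    case False
    \<comment> \<open>Here the defect may vanish, but \<open>d\<close> is itself of order
      \<open>c * r\<close>.\<close>
    have "4 * c * norm z \<le> 4 * c * (r / 8)" using z c by (intro mult_left_mono) auto
    then have "d \<le> c * r / 2" using False by simp
    then have "(r / 4 * d) * (2 * c) \<le> (r / 4 * (c * r / 2)) * (2 * c)"
      using \<open>0 < r\<close> c by (intro mult_right_mono mult_left_mono) auto
    also have "\<dots> = c\<^sup>2 * r\<^sup>2 / 4" by (simp add: power2_eq_square)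
    finally show ?thesis using arc_defect_nonneg[of \<phi> z w] by simp
  qed
  finally have "\<phi> * (\<bar>bump z0 r z - bump z0 r w\<bar> * sin (2 * \<phi>)) \<le> \<phi> * (arc_defect \<phi> z w + c\<^sup>2 * r\<^sup>2 / 4)"
    using \<phi> by (intro mult_left_mono) auto
  also have "\<dots> = \<phi> * arc_defect \<phi> z w + (c * r\<^sup>2 / 4) * (2 * (\<phi> / 2 * c))"
    by (simp add: algebra_simps power2_eq_square)
  also have "\<dots> \<le> \<phi> * arc_defect \<phi> z w + \<sigma> * sin (2 * \<phi>)"
  proof -
    \<comment> \<open>Both factors of \<open>\<sigma> * sin (2 * \<phi>)\<close> are bounded below
      by multiples of \<open>cos \<phi>\<close>, which pays for the term with
      \<open>c\<^sup>2\<close>.\<close>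
    have "c * r\<^sup>2 / 4 \<le> \<sigma>"
      using lens_slack[OF \<phi> norm_ge_zero z(1,2)] z(3) by (simp add: c_def)
    moreover have "2 * (\<phi> / 2 * c) \<le> sin (2 * \<phi>)"
      unfolding sin2 using half_le_sin[OF \<phi>] c by (intro mult_left_mono mult_right_mono) auto
    moreover have "0 \<le> c * r\<^sup>2 / 4" "0 \<le> 2 * (\<phi> / 2 * c)" using c \<phi> by auto
    ultimately have "(c * r\<^sup>2 / 4) * (2 * (\<phi> / 2 * c)) \<le> \<sigma> * sin (2 * \<phi>)"
      by (intro mult_mono) auto
    then show ?thesis by simp
  qed
  finally show ?thesis .
qed

lemma cc_diam_sheared_lens:
  fixes z0 :: "complex ^ ('n::finite)"
  assumes "0 < r" and z0: "norm z0 = r / 16"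
  shows "cc_diam (sheared_lens z0 r) \<le> ennreal (2 * r)"
  unfolding cc_diam_le_iff
proof (intro ballI)
  fix p' q' assume "p' \<in> sheared_lens z0 r" "q' \<in> sheared_lens z0 r"
  then obtain z t w u where p': "p' = (z, bump z0 r z + t)" "(z, t) \<in> lens r"
    and q': "q' = (w, bump z0 r w + u)" "(w, u) \<in> lens r"
    unfolding sheared_lens_def by (auto simp: image_iff)
  show "cc_dist p' q' \<le> ennreal (2 * r)"
  proof (rule cc_dist_upper_bound)
    show "0 \<le> 2 * r" using \<open>0 < r\<close> by simp
    fix \<psi> :: real assume "0 < \<psi>" "\<psi> < pi"
    \<comment> \<open>Half angles of \<open>(0, pi)\<close> are exactly the angles in the definition
      of \<open>lens\<close>.\<close>
    define \<phi> where "\<phi> = \<psi> / 2"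
    have \<phi>: "0 < \<phi>" "\<phi> < pi / 2" using \<open>0 < \<psi>\<close> \<open>\<psi> < pi\<close> by (auto simp: \<phi>_def)
    define \<sigma> where "\<sigma> = r\<^sup>2 - (\<phi> * cot \<phi> * (norm z)\<^sup>2 + \<phi> * \<bar>t\<bar>)"
    define \<sigma>' where "\<sigma>' = r\<^sup>2 - (\<phi> * cot \<phi> * (norm w)\<^sup>2 + \<phi> * \<bar>u\<bar>)"
    have \<sigma>: "0 \<le> \<sigma>" "0 \<le> \<sigma>'" using p'(2) q'(2) \<phi> by (auto simp: lens_def \<sigma>_def \<sigma>'_def)
    have s2: "0 \<le> sin (2 * \<phi>)" using \<phi> by (intro sin_ge_zero) auto
    have "2 * \<phi> * cot (2 * \<phi>) * (norm (w - z))\<^sup>2 + 2 * \<phi> * \<bar>height p' q'\<bar> \<le> 4 * r\<^sup>2"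
    proof (rule double_angle_bound[OF \<phi>, where \<delta> = "\<bar>bump z0 r z - bump z0 r w\<bar>"])
      show "\<bar>height p' q'\<bar> \<le> \<bar>t\<bar> + \<bar>u\<bar> + 2 * \<bar>symp z w\<bar> + \<bar>bump z0 r z - bump z0 r w\<bar>"
        by (simp add: height_def p' q' abs_if)
      show "\<phi> * cot \<phi> * (norm z)\<^sup>2 + \<phi> * \<bar>t\<bar> = r\<^sup>2 - \<sigma>" "\<phi> * cot \<phi> * (norm w)\<^sup>2 + \<phi> * \<bar>u\<bar> = r\<^sup>2 - \<sigma>'"
        by (simp_all add: \<sigma>_def \<sigma>'_def)
      have nn: "0 \<le> \<phi> * arc_defect \<phi> z w" "0 \<le> \<sigma> * sin (2 * \<phi>)" "0 \<le> \<sigma>' * sin (2 * \<phi>)"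
        using \<phi> \<sigma> s2 arc_defect_nonneg[of \<phi> z w] by auto
      consider "norm z \<le> r / 8" | "norm w \<le> r / 8" | "r / 8 < norm z" "r / 8 < norm w" by linarith
      then show "\<phi> * (\<bar>bump z0 r z - bump z0 r w\<bar> * sin (2 * \<phi>))
          \<le> \<phi> * arc_defect \<phi> z w + (\<sigma> + \<sigma>') * sin (2 * \<phi>)"
      proof cases
        case 1
        then show ?thesis
          using bump_shear_admissible[OF \<open>0 < r\<close> z0 \<phi> 1, of t \<sigma> w] p'(2) nn
          by (simp add: lens_def \<sigma>_def distrib_right)
      next
        case 2
        then show ?thesis
          using bump_shear_admissible[OF \<open>0 < r\<close> z0 \<phi> 2, of u \<sigma>' z] q'(2) nn
          by (simp add: lens_def \<sigma>'_def distrib_right arc_defect_commute abs_minus_commute)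
      next
        case 3
        \<comment> \<open>With both base points outside the support the shear leaves the height
          unchanged.\<close>
        then show ?thesis using bump_eq_0[OF z0] nn by (simp add: distrib_right)
      qed
    qed
    then show "\<psi> * cot \<psi> * (norm (fst q' - fst p'))\<^sup>2 + \<psi> * \<bar>height p' q'\<bar> \<le> (2 * r)\<^sup>2"
      by (simp add: p' q' \<phi>_def)
  qed
qed

lemma bump_continuous: "continuous_on UNIV (bump z0 r)"
  unfolding bump_def by (intro continuous_intros)

lemma
  fixes z0 :: "complex ^ ('n::finite)"
  shows compact_sheared_lens: "compact (sheared_lens z0 r)"
    and emeasure_sheared_lens: "emeasure lborel (sheared_lens z0 r) = emeasure lborel (lens r :: 'n heis set)"
  unfolding sheared_lens_def
  using emeasure_affine_shear[OF compact_lens[of r, where 'n = 'n] zero_less_one zero_less_one bump_continuous[of z0 r], of 0]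
  by auto

lemma rot_invariant_fibre_in_lens:
  assumes E: "E \<in> rot_invariant_sets" "cc_diam E \<le> ennreal (2 * r)" and "0 \<le> r"
    and zt: "(z, t) \<in> E" "(z, t') \<in> E" "t \<le> t'"
  shows "(z, (t' - t) / 2) \<in> lens r"
proof -
  \<comment> \<open>Only the upper point is rotated, by the same angle in every coordinate; suitable
    angles give the three conditions of \<open>lens\<close>.\<close>
  have rot: "cc_dist (z, t) (cis \<beta> *s z, t') \<le> ennreal (2 * r)" for \<beta>
  proof -
    have "heis_rot (\<chi> j. \<beta>) (z, t') = (cis \<beta> *s z, t')"
      by (simp add: heis_rot_def vec_eq_iff cis_conv_exp)
    moreover have "heis_rot (\<chi> j. \<beta>) ` E \<subseteq> E" using E(1) by (simp add: rot_invariant_sets_def)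
    ultimately have "(cis \<beta> *s z, t') \<in> E" using zt(2) by (metis image_subset_iff)
    then show ?thesis using E(2) zt(1) by (auto simp: cc_diam_le_iff)
  qed
  have h: "height (z, t) (cis \<beta> *s z, t') = t' - t + 2 * sin \<beta> * (norm z)\<^sup>2" for \<beta>
    using symp_complex_scale2[of 1 z "cis \<beta>"] by (simp add: height_def)
  have n: "(norm (cis \<beta> *s z - z))\<^sup>2 = (2 - 2 * cos \<beta>) * (norm z)\<^sup>2" for \<beta>
  proof -
    have "cis \<beta> *s z - z = (cis \<beta> - 1) *s z" by (simp add: vector_sub_rdistrib)
    moreover have "(cmod (cis \<beta> - 1))\<^sup>2 = 2 - 2 * cos \<beta>"
      using sin_cos_squared_add[of \<beta>] unfolding cmod_power2 by (simp add: power2_eq_square algebra_simps)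
    ultimately show ?thesis by (simp only: norm_complex_scale power_mult_distrib)
  qed
  have "norm z \<le> r"
  proof -
    have "(norm (cis pi *s z - z))\<^sup>2 = (2 * norm z)\<^sup>2" unfolding n by (simp add: power_mult_distrib)
    then have "norm (cis pi *s z - z) = 2 * norm z" by (rule power2_eq_imp_eq) auto
    then show ?thesis using norm_le_of_cc_dist[OF _ rot[of pi]] \<open>0 \<le> r\<close> by simp
  qed
  moreover have "pi * \<bar>(t' - t) / 2\<bar> \<le> 2 * r\<^sup>2"
  proof -
    \<comment> \<open>The vertical pair at angle \<open>pi\<close>, which the criterion excludes and
      which is therefore approached by \<open>x * pi\<close>.\<close>
    have "pi * (t' - t) \<le> (2 * r)\<^sup>2"
    proof (rule field_le_mult_one_interval)
      fix x :: real assume "0 < x" "x < 1"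
      then show "x * (pi * (t' - t)) \<le> (2 * r)\<^sup>2"
        using cc_dist_lower_bound[OF rot[of 0], of "x * pi"] h[of 0] \<open>0 \<le> r\<close> zt(3) by (simp add: mult.assoc)
    qed
    then show ?thesis using zt(3) by (simp add: power_mult_distrib)
  qed
  moreover have "\<phi> * cot \<phi> * (norm z)\<^sup>2 + \<phi> * \<bar>(t' - t) / 2\<bar> \<le> r\<^sup>2" if \<phi>: "0 < \<phi>" "\<phi> < pi / 2" for \<phi>
  proof -
    define s where "s = sin \<phi>"
    define c where "c = cos \<phi>"
    define A where "A = (norm z)\<^sup>2"
    have s: "0 < s" and c: "0 < c" using \<phi> by (auto simp: s_def c_def intro: sin_gt_zero cos_gt_zero)
    have one: "c\<^sup>2 = 1 - s\<^sup>2" by (simp add: s_def c_def cos_squared_eq)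
    \<comment> \<open>For \<open>\<beta> = pi - 2 * \<phi>\<close> the \<open>arc_defect\<close> of
      the two base points vanishes, so the double angle inequality can be read backwards. The sign
      of \<open>\<beta>\<close> makes the area term increase the height.\<close>
    have cosb: "cos (pi - 2 * \<phi>) = 1 - 2 * c\<^sup>2" and sinb: "sin (pi - 2 * \<phi>) = 2 * s * c"
      by (simp_all add: cos_double_cos sin_double s_def c_def)
    have cot2: "cot (2 * \<phi>) = (2 * c\<^sup>2 - 1) / (2 * s * c)"
      by (simp add: cot_def sin_double cos_double_cos s_def c_def)
    have abs: "\<bar>t' - t + 2 * (2 * s * c) * A\<bar> = t' - t + 2 * (2 * s * c) * A"
      using zt(3) s c by (intro abs_of_nonneg add_nonneg_nonneg) (auto simp: A_def)
    have "2 * \<phi> * cot (2 * \<phi>) * ((2 - 2 * (1 - 2 * c\<^sup>2)) * A) + 2 * \<phi> * (t' - t + 2 * (2 * s * c) * A) \<le> (2 * r)\<^sup>2"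
      using cc_dist_lower_bound[OF rot[of "pi - 2 * \<phi>"], of "2 * \<phi>"] \<phi> \<open>0 \<le> r\<close>
      unfolding fst_conv n h cosb sinb A_def[symmetric] abs by simp
    moreover have "2 * \<phi> * cot (2 * \<phi>) * ((2 - 2 * (1 - 2 * c\<^sup>2)) * A) + 2 * \<phi> * (2 * (2 * s * c) * A) = 4 * (\<phi> * cot \<phi> * A)"
    proof -
      have "2 * \<phi> * cot (2 * \<phi>) * ((2 - 2 * (1 - 2 * c\<^sup>2)) * A) = 4 * \<phi> * A * (c / s) * (2 * c\<^sup>2 - 1)"
        unfolding cot2 using s c by (simp add: field_simps power2_eq_square)
      moreover have "2 * \<phi> * (2 * (2 * s * c) * A) = 4 * \<phi> * A * (c / s) * (2 * s\<^sup>2)"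
        using s by (simp add: field_simps power2_eq_square)
      moreover have "cot \<phi> = c / s" by (simp add: cot_def s_def c_def)
      moreover have "2 * c\<^sup>2 - 1 + 2 * s\<^sup>2 = 1" unfolding one by simp
      then have "4 * \<phi> * A * (c / s) * (2 * c\<^sup>2 - 1) + 4 * \<phi> * A * (c / s) * (2 * s\<^sup>2) = 4 * \<phi> * A * (c / s)"
        unfolding distrib_left[symmetric] by simp
      ultimately show ?thesis by simp
    qed
    ultimately have "4 * (\<phi> * cot \<phi> * A) + 2 * \<phi> * (t' - t) \<le> 4 * r\<^sup>2"
      by (simp add: distrib_left power_mult_distrib)
    then show ?thesis using zt(3) by (simp add: A_def field_simps)
  qed
  ultimately show ?thesis by (simp add: lens_def)
qed

text \<open>A section of \<open>E\<close> may have gaps, but it lies between its lowest and highest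
  points, and the lens has a symmetric interval of that length above the same base point.\<close>

lemma emeasure_rot_invariant_le_lens:
  fixes E :: "('n::finite) heis set"
  assumes "compact E" "E \<in> rot_invariant_sets" "cc_diam E \<le> ennreal (2 * r)" and "0 \<le> r"
  shows "emeasure lborel E \<le> emeasure lborel (lens r :: 'n heis set)"
proof -
  have borel: "E \<in> sets borel" "(lens r :: 'n heis set) \<in> sets borel"
    using assms(1) compact_lens[of r, where 'n = 'n] by (auto simp: compact_imp_closed)
  have "emeasure lborel (Pair z -` E) \<le> emeasure lborel (Pair z -` (lens r :: 'n heis set))" for z
  proof (cases "Pair z -` E = {}")
    case False
    have "Pair z -` E = snd ` (E \<inter> {z} \<times> UNIV)" by force
    moreover have "compact (snd ` (E \<inter> {z} \<times> (UNIV :: real set)))"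
      using assms(1) by (intro compact_continuous_image compact_Int_closed continuous_intros closed_Times) auto
    ultimately have cpt: "compact (Pair z -` E)" by simp
    obtain t where t: "(z, t) \<in> E" "\<And>u. (z, u) \<in> E \<Longrightarrow> t \<le> u"
      using compact_attains_inf[OF cpt False] by auto
    obtain t' where t': "(z, t') \<in> E" "\<And>u. (z, u) \<in> E \<Longrightarrow> u \<le> t'"
      using compact_attains_sup[OF cpt False] by auto
    define h where "h = (t' - t) / 2"
    have "t \<le> t'" using t(2)[OF t'(1)] .
    then have "(z, h) \<in> lens r"
      unfolding h_def by (intro rot_invariant_fibre_in_lens[OF assms(2-4) t(1) t'(1)])
    have "emeasure lborel (Pair z -` E) \<le> emeasure lborel {t..t'}"
      using t t' by (intro emeasure_mono) auto
    also have "\<dots> = emeasure lborel {- h..h}"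
    proof -
      have "0 \<le> h" "h - (- h) = t' - t" using \<open>t \<le> t'\<close> by (auto simp: h_def)
      then show ?thesis using \<open>t \<le> t'\<close> by (metis emeasure_lborel_Icc neg_le_0_iff_le order_trans)
    qed
    also have "\<dots> \<le> emeasure lborel (Pair z -` (lens r :: 'n heis set))"
    proof (rule emeasure_mono)
      show "{- h..h} \<subseteq> Pair z -` lens r"
        using lens_vertical_mono[OF \<open>(z, h) \<in> lens r\<close>] by auto
      show "Pair z -` (lens r :: 'n heis set) \<in> sets lborel"
        using closed_slice[OF compact_imp_closed[OF compact_lens[of r, where 'n = 'n]], of z] by simp
    qed
    finally show ?thesis .
  qed simp
  then show ?thesis
    unfolding emeasure_lborel_slices(1)[OF borel(1)] emeasure_lborel_slices(1)[OF borel(2)]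
    by (intro nn_integral_mono)
qed

lemma heis_rot_pi: "heis_rot (\<chi> j. pi) p = (- fst p, snd p)"
  by (simp add: heis_rot_def vec_eq_iff prod_eq_iff)

text \<open>The half turn already fails. The base of the sheared lens is a ball about 0, so symmetry
  forces \<open>fst p = 0\<close>; then the top heights over \<open>z0\<close> and
  \<open>- z0\<close> disagree.\<close>

lemma sheared_lens_not_rot_invariant:
  fixes z0 :: "complex ^ ('n::finite)"
  assumes "0 < r" and z0: "norm z0 = r / 16"
  shows "heis_mult p ` sheared_lens z0 r \<notin> rot_invariant_sets"
proof
  assume "heis_mult p ` sheared_lens z0 r \<in> rot_invariant_sets"
  then have flip: "\<exists>q\<in>sheared_lens z0 r. heis_mult p q = (- fst x, snd x)"
    if "x \<in> heis_mult p ` sheared_lens z0 r" for x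
  proof -
    have "heis_rot (\<chi> j. pi) ` heis_mult p ` sheared_lens z0 r \<subseteq> heis_mult p ` sheared_lens z0 r"
      using \<open>_ \<in> rot_invariant_sets\<close> by (simp add: rot_invariant_sets_def)
    then have "heis_rot (\<chi> j. pi) x \<in> heis_mult p ` sheared_lens z0 r" using that by (metis image_subset_iff)
    then show ?thesis unfolding heis_rot_pi by (metis imageE)
  qed
  have mem: "(z, bump z0 r z + t) \<in> sheared_lens z0 r" if "(z, t) \<in> lens r" for z t
    unfolding sheared_lens_def using that by (intro image_eqI[of _ _ "(z, t)"]) auto
  have dest: "\<exists>t. (fst q, t) \<in> lens r \<and> snd q = bump z0 r (fst q) + t" if "q \<in> sheared_lens z0 r" for q
    using that unfolding sheared_lens_def by (auto simp: image_iff)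
  have "fst p = 0"
  proof (rule ccontr)
    assume "fst p \<noteq> 0"
    \<comment> \<open>The boundary point of the base farthest along \<open>fst p\<close>: the
      opposite of its translate would need a base point of norm
      \<open>2 * norm (fst p) + r\<close>.\<close>
    define x where "x = (r / norm (fst p)) *\<^sub>R fst p"
    have x: "norm x = r" using \<open>fst p \<noteq> 0\<close> \<open>0 < r\<close> by (simp add: x_def)
    have "(x, 0) \<in> lens r"
    proof -
      have "\<phi> * cot \<phi> * r\<^sup>2 \<le> r\<^sup>2" if "0 < \<phi>" "\<phi> < pi / 2" for \<phi>
      proof -
        have "\<phi> * cot \<phi> \<le> 1" using cot_le_inverse[of \<phi>] that by (simp add: field_simps)
        then have "\<phi> * cot \<phi> * r\<^sup>2 \<le> 1 * r\<^sup>2" by (intro mult_right_mono) auto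
        then show ?thesis by simp
      qed
      then show ?thesis by (simp add: lens_def x)
    qed
    then obtain q where q: "q \<in> sheared_lens z0 r" "heis_mult p q = (- fst (heis_mult p (x, bump z0 r x + 0)), snd (heis_mult p (x, bump z0 r x + 0)))"
      using flip[OF imageI[OF mem]] by blast
    have "fst p + fst q = - (fst p + x)" using arg_cong[OF q(2), of fst] by (simp only: fst_heis_mult fst_conv)
    then have "fst q = - (fst p + x) - fst p" by (metis add_diff_cancel_left')
    also have "\<dots> = - ((2 + r / norm (fst p)) *\<^sub>R fst p)" by (simp add: x_def scaleR_left_distrib scaleR_2)
    finally have "norm (fst q) = \<bar>2 + r / norm (fst p)\<bar> * norm (fst p)" by simp
    also have "\<dots> = (2 + r / norm (fst p)) * norm (fst p)"
      using \<open>0 < r\<close> by (subst abs_of_nonneg) auto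
    finally have "norm (fst q) = 2 * norm (fst p) + r"
      using \<open>fst p \<noteq> 0\<close> by (simp add: distrib_right)
    moreover have "norm (fst q) \<le> r" using dest[OF q(1)] by (auto simp: lens_def)
    ultimately show False using \<open>fst p \<noteq> 0\<close> by simp
  qed
  \<comment> \<open>The height of the flat top, from the inequality at
    \<open>pi / 2\<close>.\<close>
  define T where "T = 2 * r\<^sup>2 / pi"
  have "(z0, T) \<in> lens r"
  proof -
    have T: "pi * \<bar>T\<bar> \<le> 2 * r\<^sup>2" by (simp add: T_def)
    have z0': "norm z0 \<le> r / 8" using z0 \<open>0 < r\<close> by simp
    have "\<phi> * cot \<phi> * (norm z0)\<^sup>2 + \<phi> * \<bar>T\<bar> \<le> r\<^sup>2" if "0 < \<phi>" "\<phi> < pi / 2" for \<phi>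
    proof -
      have "0 \<le> cos \<phi> * r\<^sup>2 / 4" using that cos_gt_zero[of \<phi>] by simp
      then show ?thesis using lens_slack[OF that norm_ge_zero z0' T] by linarith
    qed
    moreover have "norm z0 \<le> r" using z0' \<open>0 < r\<close> by simp
    ultimately show ?thesis using T by (simp add: lens_def)
  qed
  then obtain q where q: "q \<in> sheared_lens z0 r"
    "heis_mult p q = (- fst (heis_mult p (z0, bump z0 r z0 + T)), snd (heis_mult p (z0, bump z0 r z0 + T)))"
    using flip[OF imageI[OF mem]] by blast
  then have "fst q = - z0" "snd q = bump z0 r z0 + T"
    using \<open>fst p = 0\<close> by (auto simp: heis_mult_symp prod_eq_iff)
  then obtain t where "(- z0, t) \<in> lens r" and t: "bump z0 r z0 + T = bump z0 r (- z0) + t"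
    using dest[OF q(1)] by auto
  then have "\<bar>t\<bar> \<le> T" by (simp add: lens_def T_def field_simps)
  moreover have "bump z0 r (- z0) = 0"
  proof -
    have "- z0 - z0 = (- 2) *\<^sub>R z0" by (simp add: scaleR_2)
    then have "norm (- z0 - z0) = 2 * norm z0" by simp
    then show ?thesis using z0 \<open>0 < r\<close> by (simp add: bump_def)
  qed
  moreover have "0 < bump z0 r z0" using \<open>0 < r\<close> by (simp add: bump_def)
  ultimately show False using t by simp
qed

lemma heis_mult_image:
  fixes E :: "('n::finite) heis set"
  assumes "compact E"
  shows "compact (heis_mult p ` E)" "emeasure lborel (heis_mult p ` E) = emeasure lborel E"
proof -
  have eq: "heis_mult p = (\<lambda>q. (fst p + 1 *\<^sub>R fst q, (snd p + 2 * symp (fst p) (fst q)) + 1 * snd q))"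
    by (rule ext) (simp add: heis_mult_symp)
  have "continuous_on UNIV (\<lambda>z. snd p + 2 * symp (fst p) z)" by (intro continuous_intros)
  note shear = emeasure_affine_shear[OF assms zero_less_one zero_less_one this, of "fst p"]
  show "compact (heis_mult p ` E)" unfolding eq by (rule shear(1))
  show "emeasure lborel (heis_mult p ` E) = emeasure lborel E" unfolding eq by (subst shear(2)) simp
qed

theorem corollary4p7:
  shows "\<exists>E :: ('n::finite) heis set.
           E \<in> isodiametric_sets \<and> (\<forall>p. heis_mult p ` E \<notin> rot_invariant_sets)"
proof -
  obtain K :: "'n heis set" where K: "K \<in> isodiametric_sets" using isodiametric_set_exists by blast
  show ?thesis
  \<comment> \<open>If no translate of \<open>K\<close> is invariant, \<open>K\<close> itself is the
    witness.\<close>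
  proof (cases "\<forall>p. heis_mult p ` K \<notin> rot_invariant_sets")
    case False
    then obtain p where p: "heis_mult p ` K \<in> rot_invariant_sets" by blast
    have "compact K" "0 < cc_diam K"
      and vol: "emeasure lborel K = isodiam_const TYPE('n) * cc_diam K ^ (2 * CARD('n) + 2)"
      using K outer_measure_of_compact[of K] by (auto simp: isodiametric_sets_def)
    obtain D where "0 \<le> D" "cc_diam K \<le> ennreal D"
      using cc_diam_bounded_lt_top compact_imp_bounded \<open>compact K\<close> by blast
    then obtain d where d: "cc_diam K = ennreal d" "0 \<le> d" by (cases "cc_diam K") (auto simp: top_unique)
    define r where "r = d / 2"
    have "0 < r" using \<open>0 < cc_diam K\<close> d by (simp add: r_def)
    have diam: "cc_diam (heis_mult p ` K) \<le> ennreal (2 * r)"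
      using d cc_diam_le_iff[of K "ennreal d"] by (auto simp: cc_diam_le_iff r_def cc_dist_heis_mult_le)
    have "emeasure lborel K \<le> emeasure lborel (lens r :: 'n heis set)"
      using emeasure_rot_invariant_le_lens[OF heis_mult_image(1)[OF \<open>compact K\<close>] p diam] \<open>0 < r\<close>
      by (simp add: heis_mult_image(2)[OF \<open>compact K\<close>])
    define z0 :: "complex ^ 'n" where "z0 = (r / 16) *\<^sub>R axis undefined 1"
    have z0: "norm z0 = r / 16" using \<open>0 < r\<close> by (simp add: z0_def)
    \<comment> \<open>Its volume is that of the lens, hence at least that of \<open>K\<close>, and
      its diameter is at most \<open>2 * r = d\<close>, the diameter of \<open>K\<close>.\<close>
    have "sheared_lens z0 r \<in> isodiametric_sets"
    proof (rule isodiametric_setsI[OF compact_sheared_lens cc_diam_sheared_lens[OF \<open>0 < r\<close> z0]])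
      show "isodiam_const TYPE('n) * ennreal (2 * r) ^ (2 * CARD('n) + 2) \<le> emeasure lborel (sheared_lens z0 r)"
        using \<open>emeasure lborel K \<le> _\<close> unfolding vol d(1) emeasure_sheared_lens by (simp add: r_def)
    qed (use \<open>0 < r\<close> in simp)
    then show ?thesis using sheared_lens_not_rot_invariant[OF \<open>0 < r\<close> z0] by blast
  qed (use K in blast)
qed

end
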